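(* Let $H$ be a dense divisible subgroup of $(\mathbb{R},+)$. Suppose that $\mathscr{R}$ is an o-minimal expansion of $(\mathbb{R},+,<)$ and $(\mathscr{R},H)$ is a dense pair. Let $\mathscr{H}$ be the structure induced on $H$ by $(\mathscr{R},H)$, and let $\boldsymbol{\mathscr{H}}$ be the completion of $\mathscr{H}$, regarded as a structure on $\mathbb{R}$. Then $\boldsymbol{\mathscr{H}}$ is interdefinable with $\mathscr{R}$.
   Context: "Definable" means first order definable with parameters. Two structures on a common domain $M$ are interdefinable if they define the same subsets of all $M^n$. The structure induced on $B\subseteq M$ by a structure $\mathscr{M}$ is the structure on $B$ with an $m$-ary predicate defining $B^m\cap X$ for every $\mathscr{M}$-definable $X\subseteq M^m$. The open core $\mathscr{M}^\circ$ of an expansion $\mathscr{M}$ of a linear order is the reduct generated by all closed $\mathscr{M}$-definable sets. Dense pair: let $\mathscr{M}$ be an o-minimal expansion of an ordered abelian group $(M,+,<)$ and $H$ a dense divisible subgroup of $(M,+)$; $(\mathscr{M},H)$ is the expansion of $\mathscr{M}$ by a unary predicate for $H$. $(\mathscr{M},H)$ is a dense pair if for all $(\mathscr{M},H)\preceq(\mathscr{N},K)$: (A1) $(\mathscr{M},H)$ is NIP; (A2) $(\mathscr{N},K)^\circ$ is interdefinable with $\mathscr{N}$; (A3) every $(\mathscr{N},K)$-definable subset of $K^n$ is of the form $K^n\cap X$ for an $\mathscr{N}$-definable $X\subseteq N^n$. Completion: for a weakly o-minimal expansion $\mathscr{M}$ of a divisible ordered abelian group $(M,+,<)$ with no $\mathscr{M}$-definable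 convex subgroups other than $\{0\}$ and $M$, a cut is a downwards closed subset of $M$ which either has no supremum in $M$ or is of the form $(-\infty,a]$ with $a\in M$. $\overline{M}$ is the set of nonempty $\mathscr{M}$-definable cuts bounded above, ordered by inclusion, with $a\in M$ identified with $(-\infty,a]$. The completion $\boldsymbol{\mathscr{M}}$ is the structure on $\overline{M}$ with an $n$-ary predicate defining the closure in $\overline{M}^n$ of every $\mathscr{M}$-definable subset of $M^n$. In the situation of the claim, $\mathscr{H}$ is such a structure (by (A3) and since $H$ is archimedean), and $\overline{H}$ is identified with $\mathbb{R}$ via $C\mapsto\sup C$ (every cut of $H$ is the trace of a real interval, hence $\mathscr{H}$-definable), so $\boldsymbol{\mathscr{H}}$ is the structure on $\mathbb{R}$ generated by the closures in $\mathbb{R}^n$ of all $\mathscr{H}$-definable subsets of $H^n$. *)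

theory Defs
  imports "HOL-Analysis.Analysis"
begin

section \<open>First-order structures and definability\<close>

text \<open>
  Languages are relational; functions are represented by their graphs, which changes neither the
  definable sets nor the elementary embeddings. Tuples are lists. A symbol of type 'r stands for one
  predicate symbol of every arity: as an n-ary predicate, r is interpreted by the elements of
  \<open>rel M r\<close> of length n. Every relational language arises in this way, by letting
  the unwanted arities be empty. The part of \<open>rel M r\<close> that is not over the universe is
  never inspected.
\<close>

record ('a, 'r) fo_struct =
  universe :: "'a set"
  rel :: "'r \<Rightarrow> 'a list set"

datatype 'r fm =
    Eq nat nat
  | Rel 'r "nat list"
  | Neg "'r fm"
  | Conj "'r fm" "'r fm"
  | Ex nat "'r fm"

primrec fv :: "'r fm \<Rightarrow> nat set" where
  "fv (Eq i j) = {i, j}"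
| "fv (Rel r is) = set is"
| "fv (Neg p) = fv p"
| "fv (Conj p q) = fv p \<union> fv q"
| "fv (Ex i p) = fv p - {i}"

primrec sat :: "('a, 'r) fo_struct \<Rightarrow> (nat \<Rightarrow> 'a) \<Rightarrow> 'r fm \<Rightarrow> bool" where
  "sat M s (Eq i j) \<longleftrightarrow> s i = s j"
| "sat M s (Rel r is) \<longleftrightarrow> map s is \<in> rel M r"
| "sat M s (Neg p) \<longleftrightarrow> \<not> sat M s p"
| "sat M s (Conj p q) \<longleftrightarrow> sat M s p \<and> sat M s q"
| "sat M s (Ex i p) \<longleftrightarrow> (\<exists>a\<in>universe M. sat M (s(i := a)) p)"

definition tuples :: "'a set \<Rightarrow> nat \<Rightarrow> 'a list set" where
  "tuples A n = {xs. length xs = n \<and> set xs \<subseteq> A}"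

text \<open>
  A list xs serves as the assignment \<open>(!) xs\<close> of its i-th entry to the variable i; free
  variables are always required to be below the length. In the next definition, ps are the parameters.
\<close>

definition definable :: "('a, 'r) fo_struct \<Rightarrow> nat \<Rightarrow> 'a list set \<Rightarrow> bool" where
  "definable M n X \<longleftrightarrow>
     (\<exists>p ps. set ps \<subseteq> universe M \<and> fv p \<subseteq> {..<n + length ps} \<and>
        X = {xs \<in> tuples (universe M) n. sat M ((!) (xs @ ps)) p})"

definition interdefinable :: "('a, 'r) fo_struct \<Rightarrow> ('a, 's) fo_struct \<Rightarrow> bool" where
  "interdefinable M N \<longleftrightarrow>
     universe M = universe N \<and> (\<forall>n X. definable M n X \<longleftrightarrow> definable N n X)"

definition elementary_embedding ::
  "('a \<Rightarrow> 'b) \<Rightarrow> ('a, 'r) fo_struct \<Rightarrow> ('b, 'r) fo_struct \<Rightarrow> bool" where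
  "elementary_embedding e M N \<longleftrightarrow>
     e ` universe M \<subseteq> universe N \<and>
     (\<forall>p xs. set xs \<subseteq> universe M \<and> fv p \<subseteq> {..<length xs} \<longrightarrow>
        (sat M ((!) xs) p \<longleftrightarrow> sat N ((!) (map e xs)) p))"

text \<open>
  NIP: no partitioned formula \<open>p(x; y)\<close>, with x of length k and y of length l, shatters
  arbitrarily large finite sets. By compactness this is a property of the theory of M.
\<close>

definition shatters :: "('a, 'r) fo_struct \<Rightarrow> 'r fm \<Rightarrow> nat \<Rightarrow> nat \<Rightarrow> nat \<Rightarrow> bool" where
  "shatters M p k l m \<longleftrightarrow>
     (\<exists>a b. (\<forall>i<m. a i \<in> tuples (universe M) k) \<and>
        (\<forall>S\<subseteq>{..<m}. b S \<in> tuples (universe M) l \<and>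
           (\<forall>i<m. sat M ((!) (a i @ b S)) p \<longleftrightarrow> i \<in> S)))"

definition nip :: "('a, 'r) fo_struct \<Rightarrow> bool" where
  "nip M \<longleftrightarrow> (\<forall>p k l. fv p \<subseteq> {..<k + l} \<longrightarrow> (\<exists>m. \<not> shatters M p k l m))"

text \<open>The predicate symbols are sets of tuples, each interpreted by itself if it belongs to F.\<close>

definition structure_on :: "'a set \<Rightarrow> 'a list set set \<Rightarrow> ('a, 'a list set) fo_struct" where
  "structure_on A F = \<lparr>universe = A, rel = (\<lambda>X. if X \<in> F then X else {})\<rparr>"

definition induced :: "'a set \<Rightarrow> ('a, 'r) fo_struct \<Rightarrow> ('a, 'a list set) fo_struct" where
  "induced B M = structure_on B {tuples B m \<inter> X | m X. definable M m X}"

definition transport :: "('a \<Rightarrow> 'b) \<Rightarrow> ('a, 'r) fo_struct \<Rightarrow> ('b, 'r) fo_struct" where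
  "transport f M = \<lparr>universe = f ` universe M, rel = (\<lambda>r. map f ` rel M r)\<rparr>"


section \<open>Ordered structures\<close>

text \<open>In the following, lt is a strict linear order on a set A.\<close>

definition order_topology_on :: "'a set \<Rightarrow> ('a \<Rightarrow> 'a \<Rightarrow> bool) \<Rightarrow> 'a topology" where
  "order_topology_on A lt = topology_generated_by
     ({A} \<union> {{x \<in> A. lt x b} | b. b \<in> A} \<union> {{x \<in> A. lt a x} | a. a \<in> A})"

text \<open>The product topology on n-tuples; \<open>listset [U1, \<dots>, Un]\<close> is the box U1 x ... x Un.\<close>

definition tuple_topology :: "'a topology \<Rightarrow> nat \<Rightarrow> 'a list topology" where
  "tuple_topology T n = topology_generated_by
     {listset Us | Us. length Us = n \<and> (\<forall>U\<in>set Us. openin T U)}"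

definition points_and_intervals :: "'a set \<Rightarrow> ('a \<Rightarrow> 'a \<Rightarrow> bool) \<Rightarrow> 'a set set" where
  "points_and_intervals A lt =
     {{a} | a. a \<in> A} \<union> {A} \<union> {{x \<in> A. lt x b} | b. b \<in> A} \<union> {{x \<in> A. lt a x} | a. a \<in> A} \<union>
     {{x \<in> A. lt a x \<and> lt x b} | a b. a \<in> A \<and> b \<in> A}"

definition o_minimal :: "('a \<Rightarrow> 'a \<Rightarrow> bool) \<Rightarrow> ('a, 'r) fo_struct \<Rightarrow> bool" where
  "o_minimal lt M \<longleftrightarrow>
     (\<forall>X. definable M 1 X \<longrightarrow>
        (\<exists>F. finite F \<and> F \<subseteq> points_and_intervals (universe M) lt \<and> {x. [x] \<in> X} = \<Union>F))"

definition open_core ::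
  "('a \<Rightarrow> 'a \<Rightarrow> bool) \<Rightarrow> ('a, 'r) fo_struct \<Rightarrow> ('a, 'a list set) fo_struct" where
  "open_core lt M = structure_on (universe M)
     {X. \<exists>n. definable M n X \<and>
        closedin (tuple_topology (order_topology_on (universe M) lt) n) X}"


section \<open>Dense pairs\<close>

datatype 'r og_sym = Less | Plus | Pred 'r

definition less_of :: "('a, 'r og_sym) fo_struct \<Rightarrow> 'a \<Rightarrow> 'a \<Rightarrow> bool" where
  "less_of M x y \<longleftrightarrow> [x, y] \<in> rel M Less"

text \<open>In the language of a pair, \<open>None\<close> is the symbol for the subgroup.\<close>

definition pair :: "('a, 'r) fo_struct \<Rightarrow> 'a set \<Rightarrow> ('a, 'r option) fo_struct" where
  "pair M H = \<lparr>universe = universe M,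
     rel = (\<lambda>r. case r of None \<Rightarrow> {[x] | x. x \<in> H} | Some r' \<Rightarrow> rel M r')\<rparr>"

definition pair_base :: "('a, 'r option) fo_struct \<Rightarrow> ('a, 'r) fo_struct" where
  "pair_base P = \<lparr>universe = universe P, rel = (\<lambda>r. rel P (Some r))\<rparr>"

definition pair_group :: "('a, 'r option) fo_struct \<Rightarrow> 'a set" where
  "pair_group P = {x \<in> universe P. [x] \<in> rel P None}"

text \<open>
  Meant for an o-minimal expansion M of an ordered abelian group and a dense divisible subgroup H.
  An elementary extension is given by an elementary embedding. The extensions P = (N, K) range over
  those with universe inside the type \<open>'a + 'r\<close>. This is no restriction: a failure of the
  second or third condition in some extension consists, for suitable parameters, of the failure of a
  set of first-order conditions, and hence by the downward Loewenheim-Skolem theorem already occurs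
  in an extension whose cardinality is at most that of M plus that of the language.
\<close>

definition dense_pair :: "('a, 'r og_sym) fo_struct \<Rightarrow> 'a set \<Rightarrow> bool" where
  "dense_pair M H \<longleftrightarrow>
     nip (pair M H) \<and>
     (\<forall>(P :: ('a + 'r, 'r og_sym option) fo_struct) e.
        elementary_embedding e (pair M H) P \<longrightarrow>
        (let N = pair_base P; K = pair_group P in
           interdefinable (open_core (less_of N) P) N \<and>
           (\<forall>n Y. definable P n Y \<and> Y \<subseteq> tuples K n \<longrightarrow>
              (\<exists>X. definable N n X \<and> Y = tuples K n \<inter> X))))"


section \<open>The completion\<close>

definition is_cut :: "('a \<Rightarrow> 'a \<Rightarrow> bool) \<Rightarrow> 'a set \<Rightarrow> 'a set \<Rightarrow> bool" where
  "is_cut lt A C \<longleftrightarrow>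
     C \<subseteq> A \<and> (\<forall>x\<in>C. \<forall>y\<in>A. lt y x \<longrightarrow> y \<in> C) \<and>
     ((\<nexists>s. s \<in> A \<and> (\<forall>x\<in>C. lt x s \<or> x = s) \<and>
          (\<forall>u\<in>A. (\<forall>x\<in>C. lt x u \<or> x = u) \<longrightarrow> lt s u \<or> s = u)) \<or>
      (\<exists>a\<in>A. C = {x \<in> A. lt x a \<or> x = a}))"

definition completion_universe ::
  "('a \<Rightarrow> 'a \<Rightarrow> bool) \<Rightarrow> ('a, 'r) fo_struct \<Rightarrow> 'a set set" where
  "completion_universe lt M =
     {C. is_cut lt (universe M) C \<and> definable M 1 {[x] | x. x \<in> C} \<and> C \<noteq> {} \<and>
        (\<exists>b\<in>universe M. \<forall>x\<in>C. lt x b \<or> x = b)}"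

text \<open>The element a is identified with the cut \<open>principal_cut lt A a\<close>.\<close>

definition principal_cut :: "('a \<Rightarrow> 'a \<Rightarrow> bool) \<Rightarrow> 'a set \<Rightarrow> 'a \<Rightarrow> 'a set" where
  "principal_cut lt A a = {x \<in> A. lt x a \<or> x = a}"

definition structure_completion ::
  "('a \<Rightarrow> 'a \<Rightarrow> bool) \<Rightarrow> ('a, 'r) fo_struct \<Rightarrow> ('a set, 'a set list set) fo_struct" where
  "structure_completion lt M = structure_on (completion_universe lt M)
     {tuple_topology (order_topology_on (completion_universe lt M) (\<subset>)) n
        closure_of (map (principal_cut lt (universe M)) ` X) | n X. definable M n X}"


section \<open>The real setting\<close>

definition dense_divisible_subgroup :: "real set \<Rightarrow> bool" where
  "dense_divisible_subgroup H \<longleftrightarrow>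
     0 \<in> H \<and> (\<forall>x\<in>H. \<forall>y\<in>H. x + y \<in> H) \<and> (\<forall>x\<in>H. - x \<in> H) \<and>
     (\<forall>x\<in>H. \<forall>n::nat. n > 0 \<longrightarrow> (\<exists>y\<in>H. real n * y = x)) \<and>
     closure H = UNIV"

definition expands_real_group :: "(real, 'r og_sym) fo_struct \<Rightarrow> bool" where
  "expands_real_group R \<longleftrightarrow>
     universe R = UNIV \<and>
     rel R Less = {[x, y] | x y. x < y} \<and>
     rel R Plus = {[x, y, z] | x y z. x + y = z}"

end

theory Submission
  imports Defs
begin

text \<open>
  Write P for the pair (R, H). The proof compares three families of sets: those definable in R, those
  definable in P, and the closures of sets definable in the structure induced on H. The link between
  the first two is that the open core of P is interdefinable with R: closed sets definable in P
  are definable in R (\<open>closed_definable_pair\<close>), and they generate R (\<open>definable_from_closed\<close>).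

  The cuts of H correspond to the real numbers by taking suprema, since H is dense and every ray
  \<open>x \<le> r\<close> leaves a definable trace on H. This is an isomorphism of orders, so the order
  topology on cuts becomes the usual topology, and the completion becomes the structure on the reals
  whose basic relations are the closures of the subsets of \<open>H\<^sup>n\<close> definable in the induced structure
  (\<open>rel_real_completion\<close>, \<open>definable_completion_real_closure\<close>).

  Completion to R: a set definable in the induced structure is definable in P, as its quantifiers can
  be relativised to H. Its closure is again definable in P, because the topology is defined by order
  and addition, and it is closed. So it is definable in R, and hence so is everything
  definable from such closures.

  R to completion: it suffices to define each closed set C that is definable in P. The set C may have
  empty trace on \<open>H\<^sup>n\<close>, but the set of all (x, t) such that x has distance less than t from C if t > 0
  is definable in P and has enough points over H: a point x lies in C if and only if, for all t,
  (x, t) lies in the closure of the trace of that set on \<open>H\<^sup>n\<^sup>+\<^sup>1\<close>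
  (\<open>closed_from_trace_of_nbhd_graph\<close>). That closure is a basic relation of the completion.
\<close>

section \<open>Definable predicates on assignments\<close>

lemma sat_cong:
  "(\<And>v. v \<in> fv p \<Longrightarrow> s v = t v) \<Longrightarrow> sat M s p = sat M t p"
proof (induction p arbitrary: s t)
  case (Rel r js)
  then have "map s js = map t js" by simp
  then show ?case by (simp only: sat.simps)
next
  case (Conj p q)
  have "sat M s p = sat M t p" by (rule Conj.IH(1)) (simp add: Conj.prems)
  moreover have "sat M s q = sat M t q" by (rule Conj.IH(2)) (simp add: Conj.prems)
  ultimately show ?case by simp
next
  case (Ex i p)
  have "sat M (s(i := a)) p = sat M (t(i := a)) p" for a
    by (rule Ex.IH) (use Ex.prems in auto)
  then show ?case by simp
next
  case (Neg p)
  have "sat M s p = sat M t p" by (rule Neg.IH) (simp add: Neg.prems)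
  then show ?case by simp
qed simp

lemma finite_fv: "finite (fv p)"
  by (induction p) auto

text \<open>
  Capture-avoiding: the bound variable is replaced by one that no free variable is sent to, so that
  non-injective renamings are allowed as well.
\<close>

primrec rename :: "'r fm \<Rightarrow> (nat \<Rightarrow> nat) \<Rightarrow> 'r fm" where
  "rename (Eq i j) f = Eq (f i) (f j)"
| "rename (Rel r js) f = Rel r (map f js)"
| "rename (Neg p) f = Neg (rename p f)"
| "rename (Conj p q) f = Conj (rename p f) (rename q f)"
| "rename (Ex i p) f = (let j = LEAST j. j \<notin> f ` fv p in Ex j (rename p (f(i := j))))"

lemma fresh_variable: "(LEAST j. j \<notin> f ` fv p) \<notin> f ` fv p" for f :: "nat \<Rightarrow> nat"
proof -
  have "\<exists>j. j \<notin> f ` fv p"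
    by (meson ex_new_if_finite finite_fv finite_imageI infinite_UNIV_nat)
  then show ?thesis by (rule LeastI_ex)
qed

lemma sat_rename: "sat M s (rename p f) = sat M (s \<circ> f) p"
proof (induction p arbitrary: s f)
  case (Ex i p)
  define j where "j = (LEAST j. j \<notin> f ` fv p)"
  have "j \<notin> f ` fv p" unfolding j_def by (rule fresh_variable)
  then have "sat M (s(j := a) \<circ> f(i := j)) p = sat M ((s \<circ> f)(i := a)) p" for a
    by (intro sat_cong) auto
  then show ?case by (simp add: Ex.IH j_def[symmetric] Let_def del: comp_apply fun_upd_apply)
qed auto

lemma fv_rename: "fv (rename p f) \<subseteq> f ` fv p"
proof (induction p arbitrary: f)
  case (Ex i p)
  define j where "j = (LEAST j. j \<notin> f ` fv p)"
  have "fv (rename p (f(i := j))) \<subseteq> f(i := j) ` fv p" by (rule Ex.IH)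
  then have "fv (rename p (f(i := j))) - {j} \<subseteq> f ` (fv p - {i})"
    by (auto split: if_splits)
  then show ?case by (simp add: j_def[symmetric] Let_def)
next
  case (Conj p q)
  then show ?case by (simp add: image_Un) blast
qed auto

text \<open>
  Definability is handled semantically, through predicates on assignments of all variables. Such a
  predicate is presented by a formula together with a map sending each variable of the formula
  either to a variable of the assignment or to a parameter. Variables of the formula are thus
  independent of those of the predicate: substituting parameters and re-indexing only change the map,
  and two formulas are combined after making their variables disjoint. No book-keeping about tuple
  lengths is needed.
\<close>

definition substitute :: "(nat \<Rightarrow> nat + 'a) \<Rightarrow> (nat \<Rightarrow> 'a) \<Rightarrow> nat \<Rightarrow> 'a" where
  "substitute f s v = (case f v of Inl i \<Rightarrow> s i | Inr a \<Rightarrow> a)"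

definition definable_pred :: "('a, 'r) fo_struct \<Rightarrow> ((nat \<Rightarrow> 'a) \<Rightarrow> bool) \<Rightarrow> bool" where
  "definable_pred M P \<longleftrightarrow>
     (\<exists>p f. (\<forall>v a. f v = Inr a \<longrightarrow> a \<in> universe M) \<and>
        (\<forall>s. range s \<subseteq> universe M \<longrightarrow> (P s \<longleftrightarrow> sat M (substitute f s) p)))"

lemma definable_pred_cong:
  assumes "definable_pred M P" "\<And>s. range s \<subseteq> universe M \<Longrightarrow> P s \<longleftrightarrow> Q s"
  shows "definable_pred M Q"
  using assms unfolding definable_pred_def by metis

lemma definable_pred_eq: "definable_pred M (\<lambda>s. s i = s j)"
  unfolding definable_pred_def
  by (rule exI[of _ "Eq i j"], rule exI[of _ Inl]) (simp add: substitute_def)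

lemma definable_pred_not: "definable_pred M P \<Longrightarrow> definable_pred M (\<lambda>s. \<not> P s)"
  unfolding definable_pred_def by (metis sat.simps(3))

lemma definable_pred_conj:
  assumes "definable_pred M P" "definable_pred M Q"
  shows "definable_pred M (\<lambda>s. P s \<and> Q s)"
proof -
  obtain p f where p: "\<And>v a. f v = Inr a \<Longrightarrow> a \<in> universe M"
      "\<And>s. range s \<subseteq> universe M \<Longrightarrow> P s \<longleftrightarrow> sat M (substitute f s) p"
    using assms(1) unfolding definable_pred_def by metis
  obtain q g where q: "\<And>v a. g v = Inr a \<Longrightarrow> a \<in> universe M"
      "\<And>s. range s \<subseteq> universe M \<Longrightarrow> Q s \<longleftrightarrow> sat M (substitute g s) q"
    using assms(2) unfolding definable_pred_def by metis
  \<comment> \<open>The variables of p become the even, those of q the odd variables of a common formula.\<close>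
  define h where "h v = (if even v then f (v div 2) else g (v div 2))" for v
  let ?r = "Conj (rename p (\<lambda>v. 2 * v)) (rename q (\<lambda>v. 2 * v + 1))"
  have "substitute h s \<circ> (\<lambda>v. 2 * v) = substitute f s"
       "substitute h s \<circ> (\<lambda>v. 2 * v + 1) = substitute g s" for s
    by (auto simp: substitute_def h_def fun_eq_iff)
  then have "P s \<and> Q s \<longleftrightarrow> sat M (substitute h s) ?r" if "range s \<subseteq> universe M" for s
    using p(2) q(2) that by (simp add: sat_rename)
  moreover have "h v = Inr a \<Longrightarrow> a \<in> universe M" for v a
    using p(1) q(1) by (auto simp: h_def split: if_splits)
  ultimately show ?thesis unfolding definable_pred_def by blast
qed

lemma definable_pred_imp:
  assumes "definable_pred M P" "definable_pred M Q"
  shows "definable_pred M (\<lambda>s. P s \<longrightarrow> Q s)"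
  by (rule definable_pred_cong[OF definable_pred_not[OF definable_pred_conj[OF assms(1)
        definable_pred_not[OF assms(2)]]]]) blast

lemma definable_pred_ex:
  assumes "definable_pred M P"
  shows "definable_pred M (\<lambda>s. \<exists>a\<in>universe M. P (s(i := a)))"
proof -
  obtain p f where p: "\<And>v a. f v = Inr a \<Longrightarrow> a \<in> universe M"
      "\<And>s. range s \<subseteq> universe M \<Longrightarrow> P s \<longleftrightarrow> sat M (substitute f s) p"
    using assms unfolding definable_pred_def by metis
  \<comment> \<open>All variables of p that stand for the i-th entry are merged into the new variable 0,
     which is then bound.\<close>
  define g where "g v = (if f v = Inl i then 0 else Suc v)" for v
  define h where "h v = (case v of 0 \<Rightarrow> Inl 0 | Suc v \<Rightarrow> f v)" for v
  have "(substitute h s)(0 := a) \<circ> g = substitute f (s(i := a))" for s a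
    by (auto simp: substitute_def h_def g_def fun_eq_iff split: sum.splits)
  moreover have "range (s(i := a)) \<subseteq> universe M" 
    if "range s \<subseteq> universe M" "a \<in> universe M" for s :: "nat \<Rightarrow> 'a" and a using that by auto
  ultimately have "(\<exists>a\<in>universe M. P (s(i := a))) \<longleftrightarrow> sat M (substitute h s) (Ex 0 (rename p g))"
    if "range s \<subseteq> universe M" for s using p(2) that by (simp add: sat_rename)
  moreover have "h v = Inr a \<Longrightarrow> a \<in> universe M" for v a
    using p(1) by (auto simp: h_def split: nat.splits)
  ultimately show ?thesis unfolding definable_pred_def by blast
qed

lemma definable_pred_all:
  assumes "definable_pred M P"
  shows "definable_pred M (\<lambda>s. \<forall>a\<in>universe M. P (s(i := a)))"
  by (rule definable_pred_cong[OF definable_pred_not[OF definable_pred_ex[OF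
        definable_pred_not[OF assms], of i]]]) blast

lemma definable_pred_substitute:
  assumes "definable_pred M P" "\<And>v a. f v = Inr a \<Longrightarrow> a \<in> universe M"
  shows "definable_pred M (\<lambda>s. P (substitute f s))"
proof -
  obtain p g where p: "\<And>v a. g v = Inr a \<Longrightarrow> a \<in> universe M"
      "\<And>s. range s \<subseteq> universe M \<Longrightarrow> P s \<longleftrightarrow> sat M (substitute g s) p"
    using assms(1) unfolding definable_pred_def by metis
  define h where "h v = (case g v of Inl i \<Rightarrow> f i | Inr a \<Rightarrow> Inr a)" for v
  have "substitute g (substitute f s) = substitute h s" for s
    by (auto simp: substitute_def h_def fun_eq_iff split: sum.splits)
  moreover have "range (substitute f s) \<subseteq> universe M" if "range s \<subseteq> universe M" for s
    using that assms(2) by (auto simp: substitute_def image_subset_iff split: sum.splits)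
  ultimately have "P (substitute f s) \<longleftrightarrow> sat M (substitute h s) p"
    if "range s \<subseteq> universe M" for s using p(2) that by metis
  moreover have "h v = Inr a \<Longrightarrow> a \<in> universe M" for v a
    using p(1) assms(2) by (auto simp: h_def split: sum.splits)
  ultimately show ?thesis unfolding definable_pred_def by blast
qed

lemma definable_pred_True: "definable_pred M (\<lambda>s. True)"
  using definable_pred_eq[of M 0 0] by simp

lemma definable_pred_ball:
  assumes "finite I" "\<And>i. i \<in> I \<Longrightarrow> definable_pred M (P i)"
  shows "definable_pred M (\<lambda>s. \<forall>i\<in>I. P i s)"
  using assms
proof (induction I)
  case empty
  show ?case by (simp add: definable_pred_True)
next
  case (insert j I)
  have "definable_pred M (\<lambda>s. P j s \<and> (\<forall>i\<in>I. P i s))"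
    using insert by (intro definable_pred_conj) auto
  then show ?case by simp
qed

text \<open>
  Quantification over a tuple of variables at once: the assignment \<open>t\<close> differs from \<open>s\<close> only at
  the indices in I.
\<close>

lemma definable_pred_ex_block:
  assumes "finite I" "definable_pred M P"
  shows "definable_pred M (\<lambda>s. \<exists>t. range t \<subseteq> universe M \<and> (\<forall>i. i \<notin> I \<longrightarrow> t i = s i) \<and> P t)"
  using assms(1)
proof (induction I)
  case empty
  have "definable_pred M P" by fact
  then show ?case by (rule definable_pred_cong) (auto simp: fun_eq_iff[symmetric])
next
  case (insert j I)
  show ?case
  proof (rule definable_pred_cong[OF definable_pred_ex[OF insert.IH, of j]])
    fix s :: "nat \<Rightarrow> 'a"
    assume "range s \<subseteq> universe M"
    show "(\<exists>a\<in>universe M. \<exists>t. range t \<subseteq> universe M \<and>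
             (\<forall>i. i \<notin> I \<longrightarrow> t i = (s(j := a)) i) \<and> P t) \<longleftrightarrow>
          (\<exists>t. range t \<subseteq> universe M \<and> (\<forall>i. i \<notin> insert j I \<longrightarrow> t i = s i) \<and> P t)"
      (is "?L \<longleftrightarrow> ?R")
    proof
      assume ?L
      then show ?R by (metis fun_upd_apply insertCI)
    next
      assume ?R
      then obtain t where t: "range t \<subseteq> universe M" "\<forall>i. i \<notin> insert j I \<longrightarrow> t i = s i" "P t"
        by blast
      then have "t j \<in> universe M" "\<forall>i. i \<notin> I \<longrightarrow> t i = (s(j := t j)) i" by auto
      with t show ?L by blast
    qed
  qed
qed

lemma definable_subset: "definable M n X \<Longrightarrow> X \<subseteq> tuples (universe M) n"
  unfolding definable_def by auto

lemma definable_pred_mem: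
  assumes "definable M n X" "length js = n"
  shows "definable_pred M (\<lambda>s. map s js \<in> X)"
proof -
  obtain p ps where p: "set ps \<subseteq> universe M" "fv p \<subseteq> {..<n + length ps}"
      "X = {xs \<in> tuples (universe M) n. sat M ((!) (xs @ ps)) p}"
    using assms(1) unfolding definable_def by blast
  define f where "f v = (if v < n then Inl (js ! v)
      else if v < n + length ps then Inr (ps ! (v - n)) else Inl 0)" for v
  have "sat M ((!) (map s js @ ps)) p = sat M (substitute f s) p" for s
    using p(2) assms(2)
    by (intro sat_cong) (auto simp: f_def substitute_def nth_append)
  moreover have "map s js \<in> tuples (universe M) n" if "range s \<subseteq> universe M" for s
    using that assms(2) by (auto simp: tuples_def)
  ultimately have "map s js \<in> X \<longleftrightarrow> sat M (substitute f s) p" if "range s \<subseteq> universe M" for s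
    using that p(3) by simp
  moreover have "f v = Inr a \<Longrightarrow> a \<in> universe M" for v a
    using p(1) by (auto simp: f_def split: if_splits)
  ultimately show ?thesis unfolding definable_pred_def by blast
qed

text \<open>
  The presenting formula may mention variables beyond the first n. Since P agrees with membership of
  the first n entries in X, their values do not matter, and all of them are read as one parameter c.
\<close>

lemma definable_if_definable_pred:
  assumes "universe M \<noteq> {}" "X \<subseteq> tuples (universe M) n" "definable_pred M P"
    and P: "\<And>s. range s \<subseteq> universe M \<Longrightarrow> map s [0..<n] \<in> X \<longleftrightarrow> P s"
  shows "definable M n X"
proof -
  obtain c where c: "c \<in> universe M" using assms(1) by blast
  obtain p f where p: "\<And>v a. f v = Inr a \<Longrightarrow> a \<in> universe M"
      "\<And>s. range s \<subseteq> universe M \<Longrightarrow> P s \<longleftrightarrow> sat M (substitute f s) p"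
    using assms(3) unfolding definable_pred_def by metis
  obtain N where N: "fv p \<subseteq> {..<N}" using finite_fv finite_nat_iff_bounded by blast
  define ps where "ps = c # map (\<lambda>v. case f v of Inl _ \<Rightarrow> c | Inr a \<Rightarrow> a) [0..<N]"
  define g where "g v = (case f v of Inl i \<Rightarrow> if i < n then i else n | Inr a \<Rightarrow> Suc (n + v))" for v
  have "xs \<in> X \<longleftrightarrow> sat M ((!) (xs @ ps)) (rename p g)" if xs: "xs \<in> tuples (universe M) n" for xs
  proof -
    define s where "s i = (if i < n then xs ! i else c)" for i
    have s: "range s \<subseteq> universe M" "map s [0..<n] = xs"
      using xs c by (auto simp: s_def tuples_def intro!: nth_equalityI)
    have "xs \<in> X \<longleftrightarrow> sat M (substitute f s) p" using P[OF s(1)] p(2)[OF s(1)] s(2) by simp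
    also have "\<dots> = sat M ((!) (xs @ ps) \<circ> g) p"
      using N xs
      by (intro sat_cong)
        (auto simp: substitute_def g_def s_def ps_def tuples_def nth_append
          simp del: upt_Suc split: sum.splits)
    finally show ?thesis by (simp add: sat_rename)
  qed
  moreover have "set ps \<subseteq> universe M"
    using c p(1) by (auto simp: ps_def split: sum.splits)
  moreover have "g ` fv p \<subseteq> {..<n + length ps}"
    using N by (auto simp: g_def ps_def split: sum.splits)
  then have "fv (rename p g) \<subseteq> {..<n + length ps}" using fv_rename[of p g] by blast
  ultimately show ?thesis unfolding definable_def using assms(2) by blast
qed

section \<open>Comparing the definable sets of two structures\<close>

lemma definable_inter:
  assumes "universe M \<noteq> {}" "definable M n X" "definable M n Y"
  shows "definable M n (X \<inter> Y)"
proof (rule definable_if_definable_pred[OF assms(1)])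
  show "X \<inter> Y \<subseteq> tuples (universe M) n" using definable_subset[OF assms(2)] by blast
  show "definable_pred M (\<lambda>s. map s [0..<n] \<in> X \<and> map s [0..<n] \<in> Y)"
    using assms by (intro definable_pred_conj definable_pred_mem) auto
qed simp

lemma definable_empty:
  assumes "universe M \<noteq> {}" shows "definable M n {}"
  by (rule definable_if_definable_pred[OF assms _ definable_pred_not[OF definable_pred_True]]) auto

lemma subset_if_tuples_subset:
  assumes "tuples A 1 \<subseteq> tuples B 1" shows "A \<subseteq> B"
proof
  fix x assume "x \<in> A"
  then have "[x] \<in> tuples A 1" by (simp add: tuples_def)
  then have "[x] \<in> tuples B 1" using assms by blast
  then show "x \<in> B" by (simp add: tuples_def)
qed

lemma definable_tuples:
  assumes "universe M \<noteq> {}" "definable M 1 (tuples A 1)"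
  shows "definable M n (tuples A n)"
proof (rule definable_if_definable_pred[OF assms(1)])
  show "definable_pred M (\<lambda>s. \<forall>i\<in>{..<n}. map s [i] \<in> tuples A 1)"
    using assms by (intro definable_pred_ball definable_pred_mem) auto
  show "tuples A n \<subseteq> tuples (universe M) n"
    using subset_if_tuples_subset[OF definable_subset[OF assms(2)]] by (auto simp: tuples_def)
qed (auto simp: tuples_def)

lemma definable_universe:
  assumes "universe M \<noteq> {}" shows "definable M n (tuples (universe M) n)"
proof (rule definable_if_definable_pred[OF assms _ definable_pred_True])
  fix s :: "nat \<Rightarrow> 'a" assume "range s \<subseteq> universe M"
  then show "map s [0..<n] \<in> tuples (universe M) n \<longleftrightarrow> True" by (auto simp: tuples_def)
qed simp

lemma definable_rel:
  assumes "universe M \<noteq> {}" shows "definable M n (rel M r \<inter> tuples (universe M) n)"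
proof -
  have "{xs \<in> tuples (universe M) n. sat M ((!) (xs @ [])) (Rel r [0..<n])}
      = rel M r \<inter> tuples (universe M) n"
    by (auto simp: tuples_def map_nth)
  then show ?thesis unfolding definable_def
    by (intro exI[of _ "Rel r [0..<n]"] exI[of _ "[]"]) auto
qed

text \<open>
  Every formula of M can be read in N: quantifiers are relativised to the universe of M, which N
  defines, and each atomic formula is replaced by a definition of the relation in N. It is stated for
  a subset of the universe because it is applied to the structure induced on H.
\<close>

lemma definable_transfer:
  assumes "universe M \<noteq> {}" "universe M \<subseteq> universe N"
    and univ: "definable N 1 (tuples (universe M) 1)"
    and rel: "\<And>r m. definable N m (rel M r \<inter> tuples (universe M) m)"
    and X: "definable M n X"
  shows "definable N n X"
proof -
  have N: "universe N \<noteq> {}" using assms(1,2) by blast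
  have mem: "definable_pred N (\<lambda>s. s i \<in> universe M)" for i
    by (rule definable_pred_cong[OF definable_pred_mem[OF univ, of "[i]"]]) (auto simp: tuples_def)
  have sat: "\<exists>Q. definable_pred N Q \<and> (\<forall>s. range s \<subseteq> universe M \<longrightarrow> (sat M s p \<longleftrightarrow> Q s))" for p
  proof (induction p)
    case (Eq i j)
    show ?case by (rule exI, rule conjI, rule definable_pred_eq[of N i j]) simp
  next
    case (Rel r js)
    show ?case
      by (rule exI, rule conjI, rule definable_pred_mem[OF rel[of "length js" r], of "js"])
        (auto simp: tuples_def)
  next
    case (Neg p)
    then obtain Q where "definable_pred N Q" "\<forall>s. range s \<subseteq> universe M \<longrightarrow> (sat M s p \<longleftrightarrow> Q s)"
      by blast
    then show ?case by (intro exI[of _ "\<lambda>s. \<not> Q s"] conjI definable_pred_not) auto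
  next
    case (Conj p q)
    then obtain Q Q' where "definable_pred N Q" "\<forall>s. range s \<subseteq> universe M \<longrightarrow> (sat M s p \<longleftrightarrow> Q s)"
      "definable_pred N Q'" "\<forall>s. range s \<subseteq> universe M \<longrightarrow> (sat M s q \<longleftrightarrow> Q' s)"
      by blast
    then show ?case by (intro exI[of _ "\<lambda>s. Q s \<and> Q' s"] conjI definable_pred_conj) auto
  next
    case (Ex i p)
    then obtain Q where Q: "definable_pred N Q"
        "\<forall>s. range s \<subseteq> universe M \<longrightarrow> (sat M s p \<longleftrightarrow> Q s)" by blast
    have "definable_pred N (\<lambda>s. \<exists>a\<in>universe N. (s(i := a)) i \<in> universe M \<and> Q (s(i := a)))"
      using Q(1) mem by (intro definable_pred_ex definable_pred_conj)
    moreover have "sat M s (Ex i p) \<longleftrightarrow>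
        (\<exists>a\<in>universe N. (s(i := a)) i \<in> universe M \<and> Q (s(i := a)))"
      if "range s \<subseteq> universe M" for s
    proof -
      have "range (s(i := a)) \<subseteq> universe M" if "a \<in> universe M" for a
        using that \<open>range s \<subseteq> universe M\<close> by auto
      then show ?thesis using Q(2) assms(2) by auto
    qed
    ultimately show ?case by blast
  qed
  obtain p ps where p: "set ps \<subseteq> universe M" "fv p \<subseteq> {..<n + length ps}"
      "X = {xs \<in> tuples (universe M) n. sat M ((!) (xs @ ps)) p}"
    using X unfolding definable_def by blast
  obtain c where c: "c \<in> universe M" using assms(1) by blast
  obtain Q where Q: "definable_pred N Q"
      "\<And>s. range s \<subseteq> universe M \<Longrightarrow> sat M s p \<longleftrightarrow> Q s" using sat by blast
  define f where "f v = (if v < n then Inl v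
      else Inr (if v < n + length ps then ps ! (v - n) else c))" for v
  have f: "f v = Inr a \<Longrightarrow> a \<in> universe M" for v a
    using p(1) c by (auto simp: f_def split: if_splits)
  show ?thesis
  proof (rule definable_if_definable_pred[OF N])
    show "X \<subseteq> tuples (universe N) n" using p(3) assms(2) by (auto simp: tuples_def)
    show "definable_pred N (\<lambda>s. (\<forall>i\<in>{..<n}. s i \<in> universe M) \<and> Q (substitute f s))"
      using f assms(2) by (intro definable_pred_conj definable_pred_ball mem
          definable_pred_substitute Q(1)) auto
    fix s :: "nat \<Rightarrow> 'a"
    have "map s [0..<n] \<in> tuples (universe M) n \<longleftrightarrow> (\<forall>i\<in>{..<n}. s i \<in> universe M)"
      by (auto simp: tuples_def)
    moreover have "sat M ((!) (map s [0..<n] @ ps)) p \<longleftrightarrow> Q (substitute f s)"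
      if "\<forall>i\<in>{..<n}. s i \<in> universe M"
    proof -
      have "sat M ((!) (map s [0..<n] @ ps)) p \<longleftrightarrow> sat M (substitute f s) p"
        using p(2) by (intro sat_cong) (auto simp: f_def substitute_def nth_append)
      moreover have "range (substitute f s) \<subseteq> universe M"
        using that p(1) c by (auto simp: substitute_def f_def intro!: subsetD[OF p(1) nth_mem])
      ultimately show ?thesis using Q(2) by simp
    qed
    ultimately show "map s [0..<n] \<in> X \<longleftrightarrow> (\<forall>i\<in>{..<n}. s i \<in> universe M) \<and> Q (substitute f s)"
      using p(3) by blast
  qed
qed

lemma rel_transport: "rel (transport f M) r = map f ` rel M r"
  by (simp add: transport_def)

text \<open>
  The relations are restricted to tuples over the universe because f is injective only there: a tuple
  from outside could otherwise have the same image as a tuple from inside.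
\<close>

lemma sat_transport:
  assumes "inj_on f (universe M)" "\<And>r. rel M r \<subseteq> lists (universe M)"
    and "\<forall>v\<in>fv p. s v \<in> universe M"
  shows "sat (transport f M) (f \<circ> s) p \<longleftrightarrow> sat M s p"
  using assms(3)
proof (induction p arbitrary: s)
  case (Eq i j)
  then show ?case using assms(1) by (auto simp: inj_on_eq_iff)
next
  case (Rel r js)
  have *: "map f (map s js) \<in> map f ` rel M r \<longleftrightarrow> map s js \<in> rel M r"
  proof (rule inj_on_image_mem_iff)
    show "inj_on (map f) (lists (universe M))"
      using assms(1) by (rule inj_on_mapI[OF inj_on_subset]) auto
    show "map s js \<in> lists (universe M)" using Rel by auto
  qed (rule assms(2))
  show ?case unfolding sat.simps map_map[symmetric] * by (simp add: transport_def * flip: map_map)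
next
  case (Ex i p)
  have "sat (transport f M) ((f \<circ> s)(i := f a)) p \<longleftrightarrow> sat M (s(i := a)) p"
    if "a \<in> universe M" for a
    unfolding fun_upd_comp[symmetric] by (rule Ex.IH) (use Ex.prems that in auto)
  moreover have "universe (transport f M) = f ` universe M" by (simp add: transport_def)
  ultimately show ?case unfolding sat.simps by (metis (no_types, lifting) imageE imageI)
qed auto

lemma tuples_image: "tuples (f ` A) n = map f ` tuples A n"
proof
  show "tuples (f ` A) n \<subseteq> map f ` tuples A n"
  proof
    fix ys assume ys: "ys \<in> tuples (f ` A) n"
    have "map f (map (inv_into A f) ys) = map id ys"
      unfolding map_map by (rule map_cong) (use ys in \<open>auto simp: tuples_def f_inv_into_f\<close>)
    moreover have "map (inv_into A f) ys \<in> tuples A n"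
      using ys by (auto simp: tuples_def intro!: inv_into_into)
    ultimately show "ys \<in> map f ` tuples A n" by (metis imageI list.map_id)
  qed
next
  show "map f ` tuples A n \<subseteq> tuples (f ` A) n"
    unfolding tuples_def by fastforce
qed

lemma definable_transport:
  assumes "inj_on f (universe M)" "\<And>r. rel M r \<subseteq> lists (universe M)" "definable M n X"
  shows "definable (transport f M) n (map f ` X)"
proof -
  obtain p ps where p: "set ps \<subseteq> universe M" "fv p \<subseteq> {..<n + length ps}"
      "X = {xs \<in> tuples (universe M) n. sat M ((!) (xs @ ps)) p}"
    using assms(3) unfolding definable_def by blast
  have sat: "sat (transport f M) ((!) (map f xs @ map f ps)) p \<longleftrightarrow> sat M ((!) (xs @ ps)) p"
    if xs: "xs \<in> tuples (universe M) n" for xs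
  proof -
    have lt: "v < length (xs @ ps)" if "v \<in> fv p" for v
      using that p(2) xs by (auto simp: tuples_def)
    have "sat (transport f M) ((!) (map f xs @ map f ps)) p
        = sat (transport f M) (f \<circ> (!) (xs @ ps)) p"
      by (rule sat_cong) (use lt in \<open>simp flip: map_append\<close>)
    also have "\<dots> = sat M ((!) (xs @ ps)) p"
    proof (rule sat_transport[OF assms(1,2)])
      have "set (xs @ ps) \<subseteq> universe M" using xs p(1) by (auto simp: tuples_def)
      then show "\<forall>v\<in>fv p. (xs @ ps) ! v \<in> universe M" using lt nth_mem by blast
    qed
    finally show ?thesis .
  qed
  have "map f ` X = {ys \<in> tuples (universe (transport f M)) n.
      sat (transport f M) ((!) (ys @ map f ps)) p}"
    using sat by (auto simp: p(3) tuples_image transport_def)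
  then show ?thesis unfolding definable_def
    using p(1,2) by (intro exI[of _ p] exI[of _ "map f ps"]) (auto simp: transport_def)
qed

lemma elementary_embedding_transport:
  fixes M :: "('a, 'r) fo_struct"
  assumes "inj_on f (universe M)" "\<And>r. rel M r \<subseteq> lists (universe M)"
  shows "elementary_embedding f M (transport f M)"
  unfolding elementary_embedding_def
proof (intro conjI allI impI)
  fix p :: "'r fm" and xs
  assume xs: "set xs \<subseteq> universe M \<and> fv p \<subseteq> {..<length xs}"
  have "sat (transport f M) ((!) (map f xs)) p = sat (transport f M) (f \<circ> (!) xs) p"
    using xs by (intro sat_cong) auto
  also have "\<dots> = sat M ((!) xs) p"
    using xs by (intro sat_transport assms) (auto simp: subset_iff)
  finally show "sat M ((!) xs) p \<longleftrightarrow> sat (transport f M) ((!) (map f xs)) p" by simp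
qed (simp add: transport_def)

section \<open>Order topologies modelled on the real line\<close>

text \<open>The maximum distance of two tuples of equal length is less than t (for the empty tuple this
  imposes nothing on t).\<close>

definition near :: "real \<Rightarrow> real list \<Rightarrow> real list \<Rightarrow> bool" where
  "near t = list_all2 (\<lambda>x y. \<bar>x - y\<bar> < t)"

lemma near_mono: "near t xs ys \<Longrightarrow> t \<le> u \<Longrightarrow> near u xs ys"
  unfolding near_def by (erule list_all2_mono) simp

lemma near_sym: "near t xs ys \<longleftrightarrow> near t ys xs"
  by (auto simp: near_def list_all2_conv_all_nth abs_minus_commute)

lemma near_trans: "near t xs ys \<Longrightarrow> near u ys zs \<Longrightarrow> near (t + u) xs zs"
  unfolding near_def by (rule list_all2_trans[rotated]) (assumption, assumption, simp)

lemma near_refl: "t > 0 \<Longrightarrow> near t xs xs"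
  unfolding near_def by (simp add: list_all2_refl)

lemma near_length: "near t xs ys \<Longrightarrow> length xs = length ys"
  unfolding near_def by (rule list_all2_lengthD)

definition real_closure :: "nat \<Rightarrow> real list set \<Rightarrow> real list set" where
  "real_closure n X = {xs. length xs = n \<and> (\<forall>t>0. \<exists>ys\<in>X. near t xs ys)}"

lemma mem_listset: "xs \<in> listset Us \<longleftrightarrow> list_all2 (\<in>) xs Us"
proof (induction Us arbitrary: xs)
  case (Cons U Us)
  then show ?case by (auto simp: set_Cons_def list_all2_Cons2)
qed simp

text \<open>
  Two order topologies have to be compared with the usual one on the real line: that of an isomorphic
  copy of the reals inside a sum type, and that of the set of definable cuts of H. Both are orders
  isomorphic to the reals, and the isomorphism f identifies closures in the tuple topology with
  closures for the maximum distance on real tuples.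
\<close>

locale modelled_on_reals =
  fixes A :: "'a set" and lt :: "'a \<Rightarrow> 'a \<Rightarrow> bool" and f :: "'a \<Rightarrow> real"
  assumes bij: "bij_betw f A UNIV"
    and lt_iff: "\<And>x y. x \<in> A \<Longrightarrow> y \<in> A \<Longrightarrow> lt x y \<longleftrightarrow> f x < f y"
begin

lemma preimage: "\<exists>a\<in>A. f a = t"
  using bij by (metis UNIV_I bij_betw_imp_surj_on image_iff)

lemma openin_order_topology:
  "openin (order_topology_on A lt) U \<longleftrightarrow>
     U \<subseteq> A \<and> (\<forall>x\<in>U. \<exists>t>0. \<forall>y\<in>A. \<bar>f x - f y\<bar> < t \<longrightarrow> y \<in> U)" (is "_ \<longleftrightarrow> ?R U")
proof
  assume "openin (order_topology_on A lt) U"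
  then have "generate_topology_on ({A} \<union> {{x \<in> A. lt x b} | b. b \<in> A} \<union> {{x \<in> A. lt a x} | a. a \<in> A}) U"
    unfolding order_topology_on_def openin_topology_generated_by_iff .
  then show "?R U"
  proof induction
    case (Int U V)
    show ?case
    proof (intro conjI ballI)
      fix x assume "x \<in> U \<inter> V"
      then obtain t u where "t > 0" "\<forall>y\<in>A. \<bar>f x - f y\<bar> < t \<longrightarrow> y \<in> U"
          "u > 0" "\<forall>y\<in>A. \<bar>f x - f y\<bar> < u \<longrightarrow> y \<in> V" using Int.IH by blast
      then show "\<exists>t>0. \<forall>y\<in>A. \<bar>f x - f y\<bar> < t \<longrightarrow> y \<in> U \<inter> V"
        by (intro exI[of _ "min t u"]) auto
    qed (use Int in auto)
  next
    case (UN K)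
    then show ?case by (meson Union_iff Sup_least)
  next
    case (Basis S)
    consider "S = A" | b where "b \<in> A" "S = {x \<in> A. lt x b}" | a where "a \<in> A" "S = {x \<in> A. lt a x}"
      using Basis by blast
    then show ?case
    proof cases
      case 1
      then show ?thesis by (auto intro: exI[of _ 1])
    next
      case 2
      then show ?thesis using lt_iff by (auto intro!: exI[of _ "f b - f _"])
    next
      case 3
      then show ?thesis using lt_iff by (auto intro!: exI[of _ "f _ - f a"])
    qed
  qed auto
next
  let ?T = "order_topology_on A lt"
  assume R: "?R U"
  have "\<exists>V. openin ?T V \<and> x \<in> V \<and> V \<subseteq> U" if x: "x \<in> U" for x
  proof -
    obtain t where t: "t > 0" "\<forall>y\<in>A. \<bar>f x - f y\<bar> < t \<longrightarrow> y \<in> U"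
      using bspec[OF conjunct2[OF R] x] by blast
    obtain a where a: "a \<in> A" "f a = f x - t" using preimage by blast
    obtain b where b: "b \<in> A" "f b = f x + t" using preimage by blast
    note ab = a b
    let ?V = "{y \<in> A. lt a y} \<inter> {y \<in> A. lt y b}"
    have "{y \<in> A. lt a y} \<in> {{x \<in> A. lt a x} | a. a \<in> A}" using ab(1) by auto
    then have 1: "openin ?T {y \<in> A. lt a y}"
      unfolding order_topology_on_def by (rule topology_generated_by_Basis[OF UnI2])
    have "{y \<in> A. lt y b} \<in> {{x \<in> A. lt x b} | b. b \<in> A}" using ab(3) by auto
    then have "openin ?T {y \<in> A. lt y b}"
      unfolding order_topology_on_def by (rule topology_generated_by_Basis[OF UnI1[OF UnI2]])
    with 1 have "openin ?T ?V" by (rule openin_Int)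
    moreover have "x \<in> ?V" using ab t R x lt_iff by auto
    moreover have "?V \<subseteq> U"
    proof
      fix y assume "y \<in> ?V"
      then have "y \<in> A" "\<bar>f x - f y\<bar> < t" using ab lt_iff by auto
      then show "y \<in> U" using t(2) by blast
    qed
    ultimately show ?thesis by (intro exI[of _ ?V] conjI)
  qed
  then show "openin ?T U" using openin_subopen[of ?T U] by blast
qed

lemma openin_ball: "openin (order_topology_on A lt) {y \<in> A. \<bar>z - f y\<bar> < t}"
  unfolding openin_order_topology
proof (intro conjI ballI)
  fix x assume "x \<in> {y \<in> A. \<bar>z - f y\<bar> < t}"
  then show "\<exists>u>0. \<forall>y\<in>A. \<bar>f x - f y\<bar> < u \<longrightarrow> y \<in> {y \<in> A. \<bar>z - f y\<bar> < t}"
    by (intro exI[of _ "t - \<bar>z - f x\<bar>"]) auto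
qed auto

lemma openin_box: 
  "openin (tuple_topology (order_topology_on A lt) (length zs)) {ys \<in> tuples A (length zs). near t zs (map f ys)}"
proof -
  let ?Us = "map (\<lambda>z. {y \<in> A. \<bar>z - f y\<bar> < t}) zs"
  have "{ys \<in> tuples A (length zs). near t zs (map f ys)} = listset ?Us"
  proof (intro set_eqI)
    fix ys
    have "ys \<in> tuples A (length zs) \<and> near t zs (map f ys) \<longleftrightarrow>
        length ys = length zs \<and> (\<forall>i<length ys. ys ! i \<in> A \<and> \<bar>zs ! i - f (ys ! i)\<bar> < t)"
      unfolding tuples_def near_def list_all2_conv_all_nth subset_code(1) all_set_conv_all_nth
      by auto
    also have "\<dots> \<longleftrightarrow> ys \<in> listset ?Us"
      unfolding mem_listset list_all2_conv_all_nth by auto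
    finally show "ys \<in> {ys \<in> tuples A (length zs). near t zs (map f ys)} \<longleftrightarrow> ys \<in> listset ?Us"
      by simp
  qed
  then show ?thesis unfolding tuple_topology_def
    by (intro topology_generated_by_Basis CollectI exI[of _ ?Us]) (auto intro: openin_ball)
qed

lemma listset_open:
  assumes "list_all2 (\<in>) xs Us" "\<forall>U\<in>set Us. openin (order_topology_on A lt) U"
  shows "\<exists>t>0. \<forall>ys. set ys \<subseteq> A \<longrightarrow> near t (map f xs) (map f ys) \<longrightarrow> list_all2 (\<in>) ys Us"
  using assms
proof (induction xs Us rule: list_all2_induct)
  case Nil
  then show ?case by (auto simp: near_def intro: exI[of _ 1])
next
  case (Cons x xs U Us)
  obtain t where t: "t > 0"
      "\<And>ys. set ys \<subseteq> A \<Longrightarrow> near t (map f xs) (map f ys) \<Longrightarrow> list_all2 (\<in>) ys Us"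
    using Cons.IH Cons.prems by auto
  obtain u where u: "u > 0" "\<And>y. y \<in> A \<Longrightarrow> \<bar>f x - f y\<bar> < u \<Longrightarrow> y \<in> U"
    using Cons.hyps(1) Cons.prems unfolding openin_order_topology by force
  have "list_all2 (\<in>) ys (U # Us)"
    if ys: "set ys \<subseteq> A" "near (min t u) (map f (x # xs)) (map f ys)" for ys
  proof -
    obtain z zs where z: "ys = z # zs" "\<bar>f x - f z\<bar> < min t u" "near (min t u) (map f xs) (map f zs)"
      using ys(2) by (cases ys) (auto simp: near_def)
    then have "list_all2 (\<in>) zs Us" using t(2)[of zs] ys(1) near_mono[OF z(3), of t] by simp
    then show ?thesis using z u(2) ys(1) by simp
  qed
  then show ?case using t(1) u(1) by (intro exI[of _ "min t u"]) simp
qed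

lemma openin_tuple_topology:
  assumes "openin (tuple_topology (order_topology_on A lt) n) W" "xs \<in> W"
  shows "xs \<in> tuples A n" 
    "\<exists>t>0. \<forall>ys\<in>tuples A n. near t (map f xs) (map f ys) \<longrightarrow> ys \<in> W"
proof -
  have "generate_topology_on {listset Us | Us. length Us = n \<and> (\<forall>U\<in>set Us. openin (order_topology_on A lt) U)} W"
    using assms(1) unfolding tuple_topology_def openin_topology_generated_by_iff .
  then have "W \<subseteq> tuples A n \<and>
      (\<forall>xs\<in>W. \<exists>t>0. \<forall>ys\<in>tuples A n. near t (map f xs) (map f ys) \<longrightarrow> ys \<in> W)"
  proof induction
    case (Int U V)
    show ?case
    proof (intro conjI ballI)
      fix x assume "x \<in> U \<inter> V"
      then obtain t u where "t > 0" "\<forall>y\<in>tuples A n. near t (map f x) (map f y) \<longrightarrow> y \<in> U"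
          "u > 0" "\<forall>y\<in>tuples A n. near u (map f x) (map f y) \<longrightarrow> y \<in> V" using Int.IH by blast
      then show "\<exists>t>0. \<forall>y\<in>tuples A n. near t (map f x) (map f y) \<longrightarrow> y \<in> U \<inter> V"
        by (intro exI[of _ "min t u"]) (auto dest: near_mono[of _ _ _ t] near_mono[of _ _ _ u])
    qed (use Int in auto)
  next
    case (UN K)
    then show ?case by (meson Union_iff Sup_least)
  next
    case (Basis S)
    then obtain Us where Us: "S = listset Us" "length Us = n"
        "\<forall>U\<in>set Us. openin (order_topology_on A lt) U" by blast
    have "xs \<in> tuples A n" if "xs \<in> S" for xs
    proof -
      have "list_all2 (\<in>) xs Us" using that Us by (simp add: mem_listset)
      moreover have "U \<subseteq> A" if "U \<in> set Us" for U
        using Us(3) that by (auto simp: openin_order_topology)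
      ultimately have "list_all2 (\<lambda>x U. x \<in> A) xs Us"
        by (simp add: list_all2_conv_all_nth) (metis nth_mem subsetD)
      then show ?thesis using Us(2)
        by (simp add: tuples_def list_all2_conv_all_nth subset_code(1) all_set_conv_all_nth)
    qed
    moreover have "\<exists>t>0. \<forall>ys\<in>tuples A n. near t (map f xs) (map f ys) \<longrightarrow> ys \<in> S"
      if "xs \<in> S" for xs
    proof -
      have "list_all2 (\<in>) xs Us" using that Us(1) by (simp add: mem_listset)
      then obtain t where "t > 0"
          "\<forall>ys. set ys \<subseteq> A \<longrightarrow> near t (map f xs) (map f ys) \<longrightarrow> list_all2 (\<in>) ys Us"
        using listset_open Us(3) by blast
      then show ?thesis unfolding Us(1) mem_listset
        by (intro exI[of _ t]) (simp add: tuples_def)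
    qed
    ultimately show ?case by blast
  qed auto
  then show "xs \<in> tuples A n"
    "\<exists>t>0. \<forall>ys\<in>tuples A n. near t (map f xs) (map f ys) \<longrightarrow> ys \<in> W"
    using assms(2) by auto
qed

lemma topspace_tuple_topology: "topspace (tuple_topology (order_topology_on A lt) n) = tuples A n"
proof
  show "topspace (tuple_topology (order_topology_on A lt) n) \<subseteq> tuples A n"
    using openin_tuple_topology(1)[OF openin_topspace] by blast
  show "tuples A n \<subseteq> topspace (tuple_topology (order_topology_on A lt) n)"
  proof
    fix xs assume xs: "xs \<in> tuples A n"
    then have "openin (tuple_topology (order_topology_on A lt) n)
        {ys \<in> tuples A n. near 1 (map f xs) (map f ys)}"
      using openin_box[of "map f xs" 1] by (simp add: tuples_def)
    moreover have "xs \<in> {ys \<in> tuples A n. near 1 (map f xs) (map f ys)}"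
      using xs by (simp add: near_refl)
    ultimately show "xs \<in> topspace (tuple_topology (order_topology_on A lt) n)"
      using openin_subset by blast
  qed
qed

lemma closure_tuple_topology:
  assumes "X \<subseteq> tuples A n"
  shows "tuple_topology (order_topology_on A lt) n closure_of X =
    {xs \<in> tuples A n. map f xs \<in> real_closure n (map f ` X)}"
proof (intro set_eqI iffI)
  let ?T = "tuple_topology (order_topology_on A lt) n"
  fix xs assume "xs \<in> ?T closure_of X"
  then have xs: "xs \<in> tuples A n" and W: "\<And>W. xs \<in> W \<Longrightarrow> openin ?T W \<Longrightarrow> \<exists>y. y \<in> X \<and> y \<in> W"
    unfolding in_closure_of topspace_tuple_topology by blast+
  have "\<exists>y\<in>X. near t (map f xs) (map f y)" if "t > 0" for t
  proof -
    let ?B = "{ys \<in> tuples A n. near t (map f xs) (map f ys)}"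
    have B: "openin ?T ?B"
      using openin_box[of "map f xs" t] xs by (simp add: tuples_def)
    have "xs \<in> ?B" using xs near_refl[OF that] by simp
    from W[OF this B] show ?thesis by blast
  qed
  then show "xs \<in> {xs \<in> tuples A n. map f xs \<in> real_closure n (map f ` X)}"
    unfolding real_closure_def using xs by (auto simp: tuples_def)
next
  let ?T = "tuple_topology (order_topology_on A lt) n"
  fix xs assume xs: "xs \<in> {xs \<in> tuples A n. map f xs \<in> real_closure n (map f ` X)}"
  have "\<exists>y. y \<in> X \<and> y \<in> W" if W: "xs \<in> W" "openin ?T W" for W
  proof -
    obtain t where t: "t > 0" "\<forall>ys\<in>tuples A n. near t (map f xs) (map f ys) \<longrightarrow> ys \<in> W"
      using openin_tuple_topology(2)[OF W(2,1)] by blast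
    obtain y where "y \<in> X" "near t (map f xs) (map f y)"
      using xs t(1) unfolding real_closure_def by blast
    then show ?thesis using t(2) assms by blast
  qed
  then show "xs \<in> ?T closure_of X"
    using xs unfolding in_closure_of topspace_tuple_topology by blast
qed

lemma image_closure_tuple_topology:
  assumes "X \<subseteq> tuples A n"
  shows "map f ` (tuple_topology (order_topology_on A lt) n closure_of X) =
    real_closure n (map f ` X)"
proof -
  have "map f ` {xs \<in> B. map f xs \<in> C} = C \<inter> map f ` B" for B C by blast
  moreover have "real_closure n (map f ` X) \<subseteq> tuples UNIV n" by (auto simp: real_closure_def tuples_def)
  moreover have "tuples UNIV n = map f ` tuples A n"
    using bij tuples_image[of f A n] by (simp add: bij_betw_def)
  ultimately show ?thesis unfolding closure_tuple_topology[OF assms] by (simp add: Int_absorb2)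
qed

lemma closedin_tuple_topology_iff:
  "closedin (tuple_topology (order_topology_on A lt) n) Z \<longleftrightarrow>
     Z \<subseteq> tuples A n \<and> real_closure n (map f ` Z) = map f ` Z"
proof (cases "Z \<subseteq> tuples A n")
  case True
  let ?T = "tuple_topology (order_topology_on A lt) n"
  have inj: "inj_on (map f) (tuples A n)"
    using bij by (intro inj_on_mapI) (auto simp: tuples_def bij_betw_def intro: inj_on_subset)
  have "?T closure_of Z \<subseteq> tuples A n"
    using closure_of_subset_topspace topspace_tuple_topology by metis
  then have "map f ` (?T closure_of Z) = map f ` Z \<longleftrightarrow> ?T closure_of Z = Z"
    using inj_on_image_eq_iff[OF inj] True by simp
  then show ?thesis
    using True by (simp add: image_closure_tuple_topology closure_of_eq)
next
  case False
  then show ?thesis using closedin_subset topspace_tuple_topology by metis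
qed

end

section \<open>Neighbourhoods and closures of definable sets\<close>

lemma near_append:
  assumes "length xs = length ys"
  shows "near t (xs @ [a]) (ys @ [b]) \<longleftrightarrow> near t xs ys \<and> \<bar>a - b\<bar> < t"
  unfolding near_def using assms by (simp add: list_all2_append)

text \<open>
  The fibre over t > 0 is the open t-neighbourhood of X; the fibres over other t are full, so that a
  universal quantifier over all t is a quantifier over all positive t. With this family X can be
  thickened to sets that meet the dense subgroup, in a first-order way.
\<close>

definition nbhd_graph :: "nat \<Rightarrow> real list set \<Rightarrow> real list set" where
  "nbhd_graph n X = {xs @ [t] | xs t. length xs = n \<and> (t > 0 \<longrightarrow> (\<exists>ys\<in>X. near t xs ys))}"

lemma mem_nbhd_graph:
  "xs @ [t] \<in> nbhd_graph n X \<longleftrightarrow> length xs = n \<and> (t > 0 \<longrightarrow> (\<exists>ys\<in>X. near t xs ys))"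
  by (auto simp: nbhd_graph_def)

lemma real_closure_nbhd_graph:
  "real_closure n X = {xs \<in> tuples UNIV n. \<forall>t\<in>UNIV. xs @ [t] \<in> nbhd_graph n X}"
  by (auto simp: real_closure_def mem_nbhd_graph tuples_def)

lemma real_closure_idem: "real_closure n (real_closure n X) = real_closure n X"
proof
  show "real_closure n (real_closure n X) \<subseteq> real_closure n X"
  proof
    fix xs assume xs: "xs \<in> real_closure n (real_closure n X)"
    have "\<exists>zs\<in>X. near t xs zs" if "t > 0" for t
    proof -
      have "t / 2 > 0" using that by simp
      then obtain ys where ys: "ys \<in> real_closure n X" "near (t / 2) xs ys"
        using xs unfolding real_closure_def[of n "real_closure n X"] by blast
      then obtain zs where "zs \<in> X" "near (t / 2) ys zs"
        using \<open>t / 2 > 0\<close> unfolding real_closure_def by blast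
      then show ?thesis using near_trans[OF ys(2), of "t / 2" zs] by auto
    qed
    then show "xs \<in> real_closure n X" using xs by (auto simp: real_closure_def)
  qed
  show "real_closure n X \<subseteq> real_closure n (real_closure n X)"
    by (force simp: real_closure_def intro: near_refl)
qed

lemma dense_between:
  assumes "closure H = UNIV" "a < (b :: real)"
  shows "\<exists>h\<in>H. a < h \<and> h < b"
proof -
  have "(a + b) / 2 \<in> closure H" "(b - a) / 2 > 0" using assms by auto
  then obtain h where h: "h \<in> H" "dist h ((a + b) / 2) < (b - a) / 2"
    unfolding closure_approachable by blast
  then show ?thesis by (intro bexI[of _ h]) (auto simp: dist_real_def abs_if field_simps split: if_splits)
qed

lemma dense_tuples:
  assumes "closure H = UNIV" "t > 0"
  shows "\<exists>hs\<in>tuples H (length xs). near t xs hs"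
proof (induction xs)
  case Nil
  show ?case by (auto simp: tuples_def near_def)
next
  case (Cons x xs)
  then obtain hs where hs: "hs \<in> tuples H (length xs)" "near t xs hs" by blast
  obtain h where "h \<in> H" "x - t < h" "h < x + t" using dense_between[OF assms(1), of "x - t" "x + t"] assms(2) by auto
  then have "h # hs \<in> tuples H (length (x # xs)) \<and> near t (x # xs) (h # hs)"
    using hs by (auto simp: near_def tuples_def)
  then show ?case by blast
qed

text \<open>
  A closed set C may miss \<open>H\<^sup>n\<close> altogether, so it cannot be recovered from its own trace. Its
  neighbourhoods can: if x is in C, points of \<open>H\<^sup>n\<^sup>+\<^sup>1\<close> close to (x, t) still lie in the graph of
  neighbourhoods of C, and conversely a point of that graph near (x, t) with t small shows that x is
  within about 2t of C. The shape of the right-hand side, a universal quantifier in front of the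
  closure of a trace on H, makes it definable in the completion.
\<close>

lemma closed_from_trace_of_nbhd_graph:
  assumes H: "closure H = UNIV" and C: "real_closure n C = C"
  shows "C = {xs \<in> tuples UNIV n. \<forall>t\<in>UNIV.
    xs @ [t] \<in> real_closure (Suc n) (tuples H (Suc n) \<inter> nbhd_graph n C)}" (is "C = ?R")
proof
  show "C \<subseteq> ?R"
  proof (intro subsetI CollectI conjI ballI)
    fix xs assume xs: "xs \<in> C"
    then have len: "length xs = n" using C by (auto simp: real_closure_def)
    then show "xs \<in> tuples UNIV n" by (simp add: tuples_def)
    fix t :: real
    have "\<exists>ys\<in>tuples H (Suc n) \<inter> nbhd_graph n C. near e (xs @ [t]) ys" if "e > 0" for e
    proof -
      \<comment> \<open>If t > 0, the approximation u of t must stay above the distance from hs to xs;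
         u > t - d >= d achieves this. If t <= 0, u is negative and the fibre over u is full.\<close>
      define d where "d = (if t > 0 then min e (t / 2) else e)"
      have d: "d > 0" "d \<le> e" "t > 0 \<Longrightarrow> d \<le> t / 2" using that by (auto simp: d_def)
      obtain hs where hs: "hs \<in> tuples H n" "near d xs hs"
        using dense_tuples[OF H d(1)] len by blast
      obtain u where u: "u \<in> H" "t - d < u" "u < t" using dense_between[OF H, of "t - d" t] d(1) by auto
      have "near u hs xs" if "u > 0"
        using near_mono[OF hs(2), of u] u(2,3) d(3) that near_sym by auto
      then have "hs @ [u] \<in> tuples H (Suc n) \<inter> nbhd_graph n C"
        using hs(1) u(1) xs by (auto simp: mem_nbhd_graph tuples_def)
      moreover have "near e (xs @ [t]) (hs @ [u])"
        using near_mono[OF hs(2) d(2)] u(2,3) d(2) near_length[OF hs(2)] by (simp add: near_append)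
      ultimately show ?thesis by blast
    qed
    then show "xs @ [t] \<in> real_closure (Suc n) (tuples H (Suc n) \<inter> nbhd_graph n C)"
      using len by (simp add: real_closure_def)
  qed
  show "?R \<subseteq> C"
  proof
    fix xs assume "xs \<in> ?R"
    then have len: "length xs = n"
      and xs: "\<And>t. xs @ [t] \<in> real_closure (Suc n) (tuples H (Suc n) \<inter> nbhd_graph n C)"
      by (auto simp: tuples_def)
    have "\<exists>zs\<in>C. near e xs zs" if "e > 0" for e
    proof -
      have e: "e / 4 > 0" using that by simp
      \<comment> \<open>At height e/2 with error e/4, the approximating height u is positive and below 3e/4.\<close>
      then obtain ys where ys: "ys \<in> tuples H (Suc n) \<inter> nbhd_graph n C"
          "near (e / 4) (xs @ [e / 2]) ys"
        using xs[of "e / 2"] unfolding real_closure_def by blast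
      then obtain hs u where hs: "ys = hs @ [u]" "length hs = n" "u > 0 \<longrightarrow> (\<exists>zs\<in>C. near u hs zs)"
        by (auto simp: nbhd_graph_def)
      then have near: "near (e / 4) xs hs" "\<bar>e / 2 - u\<bar> < e / 4"
        using ys(2) len by (auto simp: near_append)
      then have u: "u > 0" "u < 3 * e / 4" by (auto simp: abs_if split: if_splits)
      then obtain zs where "zs \<in> C" "near u hs zs" using hs(3) by blast
      then show ?thesis using near_mono[OF near_trans[OF near(1)], of u zs e] u(2) by auto
    qed
    then show "xs \<in> C" using C len by (auto simp: real_closure_def)
  qed
qed

lemma definable_all_last:
  assumes "universe M \<noteq> {}" "definable M (Suc n) D"
  shows "definable M n {xs \<in> tuples (universe M) n. \<forall>t\<in>universe M. xs @ [t] \<in> D}"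
proof (rule definable_if_definable_pred[OF assms(1)])
  show "definable_pred M (\<lambda>s. \<forall>a\<in>universe M. map (s(n := a)) [0..<Suc n] \<in> D)"
    using assms(2) by (intro definable_pred_all definable_pred_mem) auto
  fix s :: "nat \<Rightarrow> 'a" assume "range s \<subseteq> universe M"
  then show "map s [0..<n] \<in> {xs \<in> tuples (universe M) n. \<forall>t\<in>universe M. xs @ [t] \<in> D} \<longleftrightarrow>
      (\<forall>a\<in>universe M. map (s(n := a)) [0..<Suc n] \<in> D)"
    by (auto simp: tuples_def)
qed auto

locale real_group_structure =
  fixes M :: "(real, 'r) fo_struct"
  assumes univ: "universe M = UNIV"
    and less: "definable M 2 {[x, y] | x y. x < y}"
    and plus: "definable M 3 {[x, y, z] | x y z. x + y = z}"
begin

lemma definable_pred_less_add: "definable_pred M (\<lambda>s. s i < s j + s k)"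
proof -
  define l where "l = Suc (i + j + k)"
  have len: "length [j, k, l] = 3" "length [i, l] = 2" by simp_all
  have "definable_pred M (\<lambda>s. \<exists>a\<in>universe M.
      map (s(l := a)) [j, k, l] \<in> {[x, y, z] | x y z. x + y = z} \<and>
      map (s(l := a)) [i, l] \<in> {[x, y] | x y. x < y})"
    by (intro definable_pred_ex definable_pred_conj definable_pred_mem[OF plus len(1)]
        definable_pred_mem[OF less len(2)])
  then show ?thesis by (rule definable_pred_cong) (auto simp: l_def univ)
qed

text \<open>
  The distance condition \<open>\<bar>x - y\<bar> < t\<close> is expressed as \<open>x < y + t\<close> and \<open>y < x + t\<close>, and t > 0 as
  \<open>t < t + t\<close>, so that only the order and addition occur.
\<close>

lemma definable_nbhd_graph:
  assumes X: "definable M n X"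
  shows "definable M (Suc n) (nbhd_graph n X)"
proof (rule definable_if_definable_pred)
  let ?I = "{Suc n..<Suc n + n}"
  let ?P = "\<lambda>t. map t [Suc n..<Suc n + n] \<in> X \<and>
      (\<forall>i\<in>{..<n}. t i < t (Suc n + i) + t n \<and> t (Suc n + i) < t i + t n)"
  show "definable_pred M (\<lambda>s. s n < s n + s n \<longrightarrow>
      (\<exists>t. range t \<subseteq> universe M \<and> (\<forall>i. i \<notin> ?I \<longrightarrow> t i = s i) \<and> ?P t))"
    by (intro definable_pred_imp definable_pred_ex_block definable_pred_conj definable_pred_ball
        definable_pred_less_add definable_pred_mem[OF X]) auto
  fix s :: "nat \<Rightarrow> real"
  have P: "?P t \<longleftrightarrow> map t [Suc n..<Suc n + n] \<in> X \<and> near (s n) (map s [0..<n]) (map t [Suc n..<Suc n + n])"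
    if "\<forall>i. i \<notin> ?I \<longrightarrow> t i = s i" for t
  proof -
    have "near (s n) (map s [0..<n]) (map t [Suc n..<Suc n + n]) \<longleftrightarrow>
        (\<forall>i<n. \<bar>s i - t (Suc n + i)\<bar> < s n)"
      unfolding near_def list_all2_conv_all_nth by (simp del: upt_Suc)
    also have "\<dots> \<longleftrightarrow> (\<forall>i\<in>{..<n}. t i < t (Suc n + i) + t n \<and> t (Suc n + i) < t i + t n)"
    proof -
      have "t i = s i" if "i \<le> n" for i using \<open>\<forall>i. i \<notin> ?I \<longrightarrow> t i = s i\<close> that by simp
      then show ?thesis by (auto simp: abs_less_iff algebra_simps)
    qed
    finally show ?thesis by blast
  qed
  have "(\<exists>ys\<in>X. near (s n) (map s [0..<n]) ys) \<longleftrightarrow>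
      (\<exists>t. range t \<subseteq> universe M \<and> (\<forall>i. i \<notin> ?I \<longrightarrow> t i = s i) \<and> ?P t)"
  proof
    assume "\<exists>ys\<in>X. near (s n) (map s [0..<n]) ys"
    then obtain ys where ys: "ys \<in> X" "near (s n) (map s [0..<n]) ys" by blast
    define t where "t i = (if i \<in> ?I then ys ! (i - Suc n) else s i)" for i
    have t: "\<forall>i. i \<notin> ?I \<longrightarrow> t i = s i" by (simp add: t_def)
    have "map t [Suc n..<Suc n + n] = ys"
      using near_length[OF ys(2)] by (intro nth_equalityI) (auto simp: t_def simp del: upt_Suc)
    then have "?P t" unfolding P[OF t] using ys by simp
    then show "\<exists>t. range t \<subseteq> universe M \<and> (\<forall>i. i \<notin> ?I \<longrightarrow> t i = s i) \<and> ?P t"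
      using t univ by blast
  next
    assume "\<exists>t. range t \<subseteq> universe M \<and> (\<forall>i. i \<notin> ?I \<longrightarrow> t i = s i) \<and> ?P t"
    then obtain t where t: "\<forall>i. i \<notin> ?I \<longrightarrow> t i = s i" "?P t" by blast
    then show "\<exists>ys\<in>X. near (s n) (map s [0..<n]) ys" using P[OF t(1)] by blast
  qed
  then show "map s [0..<Suc n] \<in> nbhd_graph n X \<longleftrightarrow> (s n < s n + s n \<longrightarrow>
      (\<exists>t. range t \<subseteq> universe M \<and> (\<forall>i. i \<notin> ?I \<longrightarrow> t i = s i) \<and> ?P t))"
    by (simp add: mem_nbhd_graph)
qed (auto simp: univ nbhd_graph_def tuples_def)

lemma definable_real_closure: "definable M n X \<Longrightarrow> definable M n (real_closure n X)"
  using definable_all_last[OF _ definable_nbhd_graph, of n X]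
  by (simp add: real_closure_nbhd_graph univ)

lemma definable_atMost: "definable M 1 {[x] | x. x \<le> r}"
proof (rule definable_if_definable_pred)
  let ?f = "\<lambda>v :: nat. if v = 0 then Inr r else Inl 0"
  show "definable_pred M (\<lambda>s. \<not> map (substitute ?f s) [0, 1] \<in> {[x, y] | x y. x < y})"
    by (intro definable_pred_not definable_pred_substitute definable_pred_mem[OF less])
      (simp_all add: univ)
qed (auto simp: univ tuples_def substitute_def not_less)

end

section \<open>The open core of a dense pair on the real line\<close>

lemma real_group_structure_pair:
  fixes R :: "(real, 'r og_sym) fo_struct"
  assumes "expands_real_group R"
  shows "real_group_structure (pair R H)"
proof
  have R: "universe R = UNIV" "rel R Less = {[x, y] | x y. x < y}"
      "rel R Plus = {[x, y, z] | x y z. x + y = z}"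
    using assms by (auto simp: expands_real_group_def)
  show univ: "universe (pair R H) = UNIV" by (simp add: pair_def R)
  have "rel (pair R H) (Some Less) \<inter> tuples UNIV 2 = {[x, y] | x y. x < y}"
    by (auto simp: pair_def R tuples_def)
  then show "definable (pair R H) 2 {[x, y] | x y. x < y}"
    using definable_rel[of "pair R H" 2 "Some Less"] univ by simp
  have "rel (pair R H) (Some Plus) \<inter> tuples UNIV 3 = {[x, y, z] | x y z. x + y = z}"
    by (auto simp: pair_def R tuples_def)
  then show "definable (pair R H) 3 {[x, y, z] | x y z. x + y = z}"
    using definable_rel[of "pair R H" 3 "Some Plus"] univ by simp
qed

text \<open>
  The conditions of a dense pair are imposed on elementary extensions with universe inside a sum
  type. They apply to the pair itself through its isomorphic copy along \<open>Inl\<close>, and the conclusions are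
  carried back along \<open>projl\<close>.
\<close>

context
  fixes R :: "(real, 'r og_sym) fo_struct" and H :: "real set"
  assumes expands: "expands_real_group R" and dense_pair: "dense_pair R H"
begin

lemma universe_pair: "universe R = UNIV" "universe (pair R H) = UNIV"
  using expands by (simp_all add: expands_real_group_def pair_def)

abbreviation "copy \<equiv> transport (Inl :: real \<Rightarrow> real + 'r) (pair R H)"

lemma pair_base_copy: "pair_base copy = transport Inl R"
  by (simp add: pair_base_def transport_def pair_def)

lemma interdefinable_copy:
  "interdefinable (open_core (less_of (transport Inl R)) copy) (transport (Inl :: real \<Rightarrow> real + 'r) R)"
proof -
  have "elementary_embedding Inl (pair R H) copy"
    by (rule elementary_embedding_transport) (auto simp: universe_pair)
  then show ?thesis
    using dense_pair unfolding dense_pair_def Let_def pair_base_copy[symmetric] by blast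
qed

lemma modelled_copy:
  "modelled_on_reals (range (Inl :: real \<Rightarrow> real + 'r)) (less_of (transport Inl R)) projl"
proof
  show "bij_betw projl (range (Inl :: real \<Rightarrow> real + 'r)) UNIV"
    by (auto simp: bij_betw_def inj_on_def image_image)
  fix x y :: "real + 'r" assume "x \<in> range Inl" "y \<in> range Inl"
  then obtain a b where [simp]: "x = Inl a" "y = Inl b" by blast
  have "map Inl [a, b] \<in> map (Inl :: real \<Rightarrow> real + 'r) ` {[x, y] | x y. x < y} \<longleftrightarrow>
      [a, b] \<in> {[x, y] | x y. x < y}"
    by (rule inj_image_mem_iff) simp
  then show "less_of (transport Inl R) x y \<longleftrightarrow> projl x < projl y"
    using expands by (simp add: less_of_def transport_def expands_real_group_def)
qed

text \<open>
  One inclusion of the interdefinability of R with the open core of the pair: a closed set definable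
  in the pair is a basic relation of the open core.
\<close>

lemma closed_definable_pair:
  assumes "definable (pair R H) n X" "real_closure n X = X"
  shows "definable R n X"
proof -
  interpret modelled_on_reals "range (Inl :: real \<Rightarrow> real + 'r)" "less_of (transport Inl R)" projl
    by (rule modelled_copy)
  let ?C = "open_core (less_of (transport Inl R)) copy"
  let ?Z = "map (Inl :: real \<Rightarrow> real + 'r) ` X"
  have Z: "map projl ` ?Z = X" by (simp add: image_image comp_def)
  have def: "definable copy n ?Z"
    by (rule definable_transport[OF _ _ assms(1)]) (auto simp: universe_pair)
  have univ: "universe copy = range Inl" by (simp add: transport_def universe_pair)
  have sub: "?Z \<subseteq> tuples (range Inl) n" using definable_subset[OF def] univ by simp
  then have "closedin (tuple_topology (order_topology_on (universe copy) (less_of (transport Inl R))) n) ?Z"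
    unfolding univ closedin_tuple_topology_iff Z using assms(2) by simp
  then have "rel ?C ?Z = ?Z" using def by (auto simp: open_core_def structure_on_def)
  moreover have uC: "universe ?C = range Inl" using univ by (simp add: open_core_def structure_on_def)
  ultimately have "definable ?C n ?Z"
    using definable_rel[of ?C n ?Z] sub by (simp add: Int_absorb2)
  then have "definable (transport (Inl :: real \<Rightarrow> real + 'r) R) n ?Z"
    using interdefinable_copy by (simp add: interdefinable_def)
  then have "definable (transport projl (transport (Inl :: real \<Rightarrow> real + 'r) R)) n (map projl ` ?Z)"
    by (rule definable_transport[rotated 2]) (auto simp: transport_def universe_pair inj_on_def)
  moreover have "transport projl (transport (Inl :: real \<Rightarrow> real + 'r) R) = R"
    by (simp add: transport_def image_image comp_def)
  ultimately show ?thesis unfolding Z by simp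
qed

text \<open>
  The other inclusion: R is generated by the closed sets definable in the pair, so a structure K
  that defines all of these defines every set definable in R.
\<close>

lemma definable_from_closed:
  assumes "universe K = UNIV"
    and closed: "\<And>m Z. definable (pair R H) m Z \<Longrightarrow> real_closure m Z = Z \<Longrightarrow> definable K m Z"
    and X: "definable R n X"
  shows "definable K n X"
proof -
  interpret modelled_on_reals "range (Inl :: real \<Rightarrow> real + 'r)" "less_of (transport Inl R)" projl
    by (rule modelled_copy)
  let ?C = "open_core (less_of (transport Inl R)) copy"
  have univ: "universe copy = range Inl" by (simp add: transport_def universe_pair)
  then have uC: "universe ?C = range Inl" by (simp add: open_core_def structure_on_def)
  have rel: "rel ?C Z = {} \<or> (\<exists>m. rel ?C Z = Z \<and> definable copy m Z \<and> Z \<subseteq> tuples (range Inl) m \<and>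
      real_closure m (map projl ` Z) = map projl ` Z)" for Z
  proof (cases "\<exists>m. definable copy m Z \<and>
      closedin (tuple_topology (order_topology_on (universe copy) (less_of (transport Inl R))) m) Z")
    case True
    then obtain m where m: "definable copy m Z" "Z \<subseteq> tuples (range Inl) m"
        "real_closure m (map projl ` Z) = map projl ` Z"
      unfolding univ closedin_tuple_topology_iff by blast
    moreover have "rel ?C Z = Z" using True by (simp add: open_core_def structure_on_def)
    ultimately show ?thesis by blast
  next
    case False
    then have "rel ?C Z = {}" unfolding open_core_def structure_on_def by auto
    then show ?thesis ..
  qed
  have lists: "rel ?C Z \<subseteq> lists (universe ?C)" for Z
    using rel[of Z] unfolding uC by (auto simp: tuples_def)
  have "definable (transport (Inl :: real \<Rightarrow> real + 'r) R) n (map Inl ` X)"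
    by (rule definable_transport[OF _ _ X]) (auto simp: universe_pair)
  then have "definable ?C n (map Inl ` X)"
    using interdefinable_copy by (simp add: interdefinable_def)
  then have "definable (transport projl ?C) n (map projl ` map (Inl :: real \<Rightarrow> real + 'r) ` X)"
    by (rule definable_transport[OF _ lists, rotated]) (simp add: uC inj_on_def)
  then have "definable (transport projl ?C) n X" by (simp add: image_image comp_def)
  moreover have uT: "universe (transport projl ?C) = UNIV"
    using uC by (simp add: transport_def image_image)
  moreover have "definable K m (rel (transport projl ?C) Z \<inter> tuples UNIV m)" for m Z
    using rel[of Z]
  proof (elim disjE exE conjE)
    assume "rel ?C Z = {}"
    then show ?thesis using assms(1) by (simp add: rel_transport definable_empty)
  next
    fix m' assume Z: "rel ?C Z = Z" "definable copy m' Z" "Z \<subseteq> tuples (range Inl) m'"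
        "real_closure m' (map projl ` Z) = map projl ` Z"
    have relT: "rel (transport projl ?C) Z = map projl ` Z" by (simp only: rel_transport Z(1))
    have "definable (transport projl copy) m' (map projl ` Z)"
      by (rule definable_transport[OF _ _ Z(2)]) (auto simp: transport_def universe_pair inj_on_def)
    moreover have "transport projl copy = pair R H"
      by (simp add: transport_def image_image comp_def)
    ultimately have "definable K m' (map projl ` Z)" using Z(4) closed by simp
    moreover have "map projl ` Z \<inter> tuples UNIV m = (if m = m' then map projl ` Z else {})"
      using Z(3) by (auto simp: tuples_def)
    ultimately show ?thesis unfolding relT using assms(1) by (simp add: definable_empty)
  qed
  ultimately show ?thesis
    using assms(1) definable_universe[of K 1] definable_transfer[of "transport projl ?C" K n X] by simp
qed

end

section \<open>The completion of the induced structure\<close>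

lemma Sup_trace:
  assumes "closure H = (UNIV :: real set)"
  shows "Sup {x \<in> H. x \<le> r} = r"
proof (rule cSup_eq_non_empty)
  show "{x \<in> H. x \<le> r} \<noteq> {}" using dense_between[OF assms, of "r - 1" r] by auto
  fix u assume u: "\<And>x. x \<in> {x \<in> H. x \<le> r} \<Longrightarrow> x \<le> u"
  show "r \<le> u"
  proof (rule ccontr)
    assume "\<not> r \<le> u"
    then obtain h where "h \<in> H" "u < h" "h < r" using dense_between[OF assms, of u r] by auto
    then show False using u[of h] by simp
  qed
qed simp

text \<open>
  If Sup C lies outside H, the cut is determined by its real supremum. If it lies in H, it is also
  the supremum of C within H, so C is of the form \<open>{x \<in> H. x \<le> a}\<close> and then a = Sup C.
\<close>

lemma cut_is_trace:
  assumes "is_cut (<) H C" "C \<noteq> {}" "\<forall>x\<in>C. x \<le> (b :: real)"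
  shows "C = {x \<in> H. x \<le> Sup C}"
proof
  have bdd: "bdd_above C" using assms(3) by auto
  have C: "C \<subseteq> H" "\<And>x y. x \<in> C \<Longrightarrow> y \<in> H \<Longrightarrow> y < x \<Longrightarrow> y \<in> C"
    using assms(1) unfolding is_cut_def by blast+
  show "C \<subseteq> {x \<in> H. x \<le> Sup C}" using C(1) bdd by (auto intro: cSup_upper)
  show "{x \<in> H. x \<le> Sup C} \<subseteq> C"
  proof
    fix x assume "x \<in> {x \<in> H. x \<le> Sup C}"
    then consider "x \<in> H" "x < Sup C" | "x \<in> H" "x = Sup C" by force
    then show "x \<in> C"
    proof cases
      case 1
      then obtain c where "c \<in> C" "x < c" using less_cSup_iff[OF assms(2) bdd] by blast
      then show ?thesis using C(2) 1(1) by blast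
    next
      case 2
      have "\<exists>s. s \<in> H \<and> (\<forall>x\<in>C. x < s \<or> x = s) \<and>
          (\<forall>u\<in>H. (\<forall>x\<in>C. x < u \<or> x = u) \<longrightarrow> s < u \<or> s = u)"
      proof (intro exI[of _ x] conjI ballI impI)
        fix c assume "c \<in> C"
        then show "c < x \<or> c = x" using cSup_upper[OF _ bdd] 2 by force
      next
        fix u assume "\<forall>c\<in>C. c < u \<or> c = u"
        then show "x < u \<or> x = u" using cSup_least[OF assms(2), of u] 2 by force
      qed (use 2 in simp)
      then obtain a where a: "a \<in> H" "C = {x \<in> H. x < a \<or> x = a}"
        using assms(1) unfolding is_cut_def by blast
      then have "Sup C = a" by (intro cSup_eq_maximum) auto
      then show ?thesis using a 2 by auto
    qed
  qed
qed

lemma trace_is_cut: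
  assumes H: "closure H = (UNIV :: real set)"
  shows "is_cut (<) H {x \<in> H. x \<le> r}"
proof -
  have "\<not> (s \<in> H \<and> (\<forall>x\<in>{x \<in> H. x \<le> r}. x < s \<or> x = s) \<and>
      (\<forall>u\<in>H. (\<forall>x\<in>{x \<in> H. x \<le> r}. x < u \<or> x = u) \<longrightarrow> s < u \<or> s = u))"
    if "r \<notin> H" for s
  proof
    assume s: "s \<in> H \<and> (\<forall>x\<in>{x \<in> H. x \<le> r}. x < s \<or> x = s) \<and>
      (\<forall>u\<in>H. (\<forall>x\<in>{x \<in> H. x \<le> r}. x < u \<or> x = u) \<longrightarrow> s < u \<or> s = u)"
    then have "s \<noteq> r" using that by blast
    then consider "s < r" | "r < s" by linarith
    then show False
    proof cases
      case 1
      then obtain h where "h \<in> H" "s < h" "h < r" using dense_between[OF H] by blast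
      then show False using s by force
    next
      case 2
      then obtain h where h: "h \<in> H" "r < h" "h < s" using dense_between[OF H] by blast
      then have "\<forall>x\<in>{x \<in> H. x \<le> r}. x < h \<or> x = h" by auto
      then show False using s h by force
    qed
  qed
  moreover have "{x \<in> H. x \<le> r} = {x \<in> H. x < r \<or> x = r}" by auto
  ultimately have "(\<nexists>s. s \<in> H \<and> (\<forall>x\<in>{x \<in> H. x \<le> r}. x < s \<or> x = s) \<and>
      (\<forall>u\<in>H. (\<forall>x\<in>{x \<in> H. x \<le> r}. x < u \<or> x = u) \<longrightarrow> s < u \<or> s = u)) \<or>
      (\<exists>a\<in>H. {x \<in> H. x \<le> r} = {x \<in> H. x < a \<or> x = a})" by blast
  then show ?thesis unfolding is_cut_def by (intro conjI) auto
qed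

lemma universe_induced: "universe (induced B M) = B"
  by (simp add: induced_def structure_on_def)

lemma definable_induced_trace:
  assumes "B \<noteq> {}" "definable M n X"
  shows "definable (induced B M) n (tuples B n \<inter> X)"
proof -
  have "rel (induced B M) (tuples B n \<inter> X) = tuples B n \<inter> X"
    using assms(2) by (auto simp: induced_def structure_on_def)
  then show ?thesis
    using definable_rel[of "induced B M" n "tuples B n \<inter> X"] assms(1)
    by (simp add: universe_induced Int_commute Int_left_commute)
qed

text \<open>
  Basic relations of the induced structure are traces of definable sets, and its quantifiers range
  over H, which is definable.
\<close>

lemma definable_of_induced:
  assumes "B \<noteq> {}" "definable M 1 (tuples B 1)" "definable (induced B M) n X"
  shows "definable M n X"
proof (rule definable_transfer[OF _ _ _ _ assms(3)])
  have B: "B \<subseteq> universe M" by (rule subset_if_tuples_subset[OF definable_subset[OF assms(2)]])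
  then have M: "universe M \<noteq> {}" using assms(1) by blast
  show "universe (induced B M) \<noteq> {}" "universe (induced B M) \<subseteq> universe M"
    using assms(1) B by (simp_all add: universe_induced)
  show "definable M 1 (tuples (universe (induced B M)) 1)"
    using assms(2) by (simp add: universe_induced)
  fix r m
  show "definable M m (rel (induced B M) r \<inter> tuples (universe (induced B M)) m)"
  proof (cases "\<exists>k X. r = tuples B k \<inter> X \<and> definable M k X")
    case True
    then obtain k X where r: "r = tuples B k \<inter> X" "definable M k X" by blast
    then have "rel (induced B M) r = r" by (auto simp: induced_def structure_on_def)
    moreover have "r \<inter> tuples B m = (if k = m then tuples B k \<inter> X else {})"
      unfolding r(1) by (auto simp: tuples_def)
    ultimately show ?thesis
      using definable_inter[OF M definable_tuples[OF M assms(2)] r(2)] definable_empty[OF M]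
      by (auto simp: universe_induced)
  next
    case False
    then have "rel (induced B M) r = {}" unfolding induced_def structure_on_def by auto
    then show ?thesis using definable_empty[OF M] by simp
  qed
qed

text \<open>
  Every real number r occurs because the ray \<open>x \<le> r\<close> is definable in M with the parameter r, which
  need not belong to H; its trace is then one of the basic relations of the induced structure.
\<close>

lemma completion_universe_induced:
  fixes M :: "(real, 'r) fo_struct"
  assumes "real_group_structure M" and H: "closure H = UNIV"
  shows "completion_universe (<) (induced H M) = range (\<lambda>r. {x \<in> H. x \<le> r})"
proof (intro equalityI subsetI)
  fix C assume "C \<in> completion_universe (<) (induced H M)"
  then obtain b where "is_cut (<) H C" "C \<noteq> {}" "\<forall>x\<in>C. x < b \<or> x = b"
    unfolding completion_universe_def universe_induced by blast
  then have "C = {x \<in> H. x \<le> Sup C}" using cut_is_trace[of H C b] by force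
  then show "C \<in> range (\<lambda>r. {x \<in> H. x \<le> r})" by blast
next
  interpret real_group_structure M by fact
  fix C assume "C \<in> range (\<lambda>r. {x \<in> H. x \<le> r})"
  then obtain r where C: "C = {x \<in> H. x \<le> r}" by blast
  have ne: "C \<noteq> {}" using dense_between[OF H, of "r - 1" r] C by auto
  obtain b where "b \<in> H" "r < b" using dense_between[OF H, of r "r + 1"] by auto
  then have "\<exists>b\<in>H. \<forall>x\<in>C. x < b \<or> x = b" using C by (intro bexI[of _ b]) auto
  moreover have "definable (induced H M) 1 {[x] | x. x \<in> C}"
  proof -
    have "H \<noteq> {}" using ne C by blast
    then have "definable (induced H M) 1 (tuples H 1 \<inter> {[x] | x. x \<le> r})"
      by (rule definable_induced_trace[OF _ definable_atMost])
    moreover have "tuples H 1 \<inter> {[x] | x. x \<le> r} = {[x] | x. x \<in> C}"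
      unfolding C by (auto simp: tuples_def)
    ultimately show ?thesis by simp
  qed
  moreover have "is_cut (<) H C" unfolding C by (rule trace_is_cut[OF H])
  ultimately show "C \<in> completion_universe (<) (induced H M)"
    using ne by (simp only: completion_universe_def universe_induced mem_Collect_eq simp_thms)
qed

lemma modelled_completion:
  fixes M :: "(real, 'r) fo_struct"
  assumes "real_group_structure M" and H: "closure H = UNIV"
  shows "modelled_on_reals (completion_universe (<) (induced H M)) (\<subset>) Sup"
proof -
  define A where "A = completion_universe (<) (induced H M)"
  define T where "T r = {x \<in> H. x \<le> r}" for r
  have A: "A = range T"
    using completion_universe_induced[OF assms] unfolding A_def T_def[abs_def] .
  have Sup: "Sup (T r) = r" for r unfolding T_def by (rule Sup_trace[OF H])
  have mono: "T r \<subset> T s" if rs: "r < s" for r s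
  proof -
    obtain h where "h \<in> H" "r < h" "h < s" using dense_between[OF H rs] by blast
    then have "h \<in> T s" "h \<notin> T r" "T r \<subseteq> T s" unfolding T_def by auto
    then show ?thesis by blast
  qed
  have "modelled_on_reals A (\<subset>) Sup"
  proof
    show "bij_betw Sup A UNIV"
      unfolding A by (rule bij_betw_byWitness[where f' = T]) (auto simp: Sup)
    fix C D assume "C \<in> A" "D \<in> A"
    then obtain r s where rs: "C = T r" "D = T s" unfolding A by blast
    show "C \<subset> D \<longleftrightarrow> Sup C < Sup D"
      unfolding rs Sup using mono[of r s] mono[of s r] less_asym[of "T r" "T s"]
      by (cases r s rule: linorder_cases) blast+
  qed
  then show ?thesis unfolding A_def .
qed

abbreviation real_completion :: "real set \<Rightarrow> (real, 'r) fo_struct \<Rightarrow> (real, real set list set) fo_struct" where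
  "real_completion H M \<equiv> transport Sup (structure_completion (<) (induced H M))"

abbreviation "completion_rels H M \<equiv>
  {tuple_topology (order_topology_on (completion_universe (<) (induced H M)) (\<subset>)) n
    closure_of (map (principal_cut (<) H) ` X) | n X. definable (induced H M) n X}"

lemma rel_real_completion_eq:
  "rel (real_completion H M) r = map Sup ` (if r \<in> completion_rels H M then r else {})"
  by (simp only: transport_def structure_completion_def structure_on_def fo_struct.simps universe_induced)

lemma universe_real_completion:
  fixes M :: "(real, 'r) fo_struct"
  assumes "real_group_structure M" "closure H = UNIV"
  shows "universe (real_completion H M) = UNIV"
proof -
  have "universe (real_completion H M) = Sup ` completion_universe (<) (induced H M)"
    by (simp only: transport_def structure_completion_def structure_on_def fo_struct.simps)
  then show ?thesis
    using bij_betw_imp_surj_on[OF modelled_on_reals.bij[OF modelled_completion[OF assms]]] by simp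
qed

text \<open>
  Under the identification of cuts with reals, the principal cut of a becomes a itself, so that the
  basic relations of the completion become ordinary closures of sets definable on H.
\<close>

lemma image_closure_completion:
  fixes M :: "(real, 'r) fo_struct"
  assumes M: "real_group_structure M" "closure H = UNIV" and X: "definable (induced H M) n X"
  defines "A \<equiv> completion_universe (<) (induced H M)"
  shows "map Sup ` (tuple_topology (order_topology_on A (\<subset>)) n closure_of
    (map (principal_cut (<) H) ` X)) = real_closure n X"
proof -
  interpret modelled_on_reals A "(\<subset>)" Sup unfolding A_def by (rule modelled_completion[OF M])
  have cut: "principal_cut (<) H a = {x \<in> H. x \<le> a}" for a :: real
    by (auto simp: principal_cut_def)
  then have "principal_cut (<) H a \<in> A" "Sup (principal_cut (<) H a) = a" for a
    unfolding A_def completion_universe_induced[OF M] using Sup_trace[OF M(2)] by auto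
  moreover have "X \<subseteq> tuples H n" using definable_subset[OF X] by (simp add: universe_induced)
  ultimately have "map (principal_cut (<) H) ` X \<subseteq> tuples A n"
    "map Sup ` map (principal_cut (<) H) ` X = X"
    by (auto simp: tuples_def image_image comp_def)
  then show ?thesis using image_closure_tuple_topology by simp
qed

lemma rel_real_completion:
  fixes M :: "(real, 'r) fo_struct"
  assumes M: "real_group_structure M" "closure H = UNIV"
  shows "rel (real_completion H M) r = {} \<or>
    (\<exists>m X. definable (induced H M) m X \<and> rel (real_completion H M) r = real_closure m X)"
proof (cases "r \<in> completion_rels H M")
  case True
  then obtain n X where X: "definable (induced H M) n X"
      "r = tuple_topology (order_topology_on (completion_universe (<) (induced H M)) (\<subset>)) n
        closure_of (map (principal_cut (<) H) ` X)" by blast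
  then have "rel (real_completion H M) r = real_closure n X"
    using image_closure_completion[OF M X(1)] True by (simp only: rel_real_completion_eq if_True)
  then show ?thesis using X(1) by blast
next
  case False
  then have "rel (real_completion H M) r = {}" by (simp only: rel_real_completion_eq if_False image_empty)
  then show ?thesis ..
qed

lemma definable_completion_real_closure:
  fixes M :: "(real, 'r) fo_struct"
  assumes M: "real_group_structure M" "closure H = UNIV" and X: "definable (induced H M) n X"
  shows "definable (real_completion H M) n (real_closure n X)"
proof -
  let ?A = "completion_universe (<) (induced H M)"
  let ?r = "tuple_topology (order_topology_on ?A (\<subset>)) n closure_of (map (principal_cut (<) H) ` X)"
  have "rel (real_completion H M) ?r = map Sup ` ?r"
    using X by (subst rel_real_completion_eq) auto
  then have "rel (real_completion H M) ?r = real_closure n X"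
    using image_closure_completion[OF M X] by simp
  moreover have "real_closure n X \<subseteq> tuples UNIV n" by (auto simp: real_closure_def tuples_def)
  ultimately show ?thesis
    using definable_rel[of "real_completion H M" n ?r] universe_real_completion[OF M]
    by (simp add: Int_absorb2)
qed

theorem lemma7p4:
  fixes R :: "(real, 'r og_sym) fo_struct" and H :: "real set"
  assumes "dense_divisible_subgroup H"
    and "expands_real_group R"
    and "o_minimal (<) R"
    and "dense_pair R H"
  shows "interdefinable (transport Sup (structure_completion (<) (induced H (pair R H)))) R"
proof -
  let ?P = "pair R H"
  let ?K = "real_completion H ?P"
  have H: "closure H = UNIV" "H \<noteq> {}" using assms(1) by (auto simp: dense_divisible_subgroup_def)
  have P: "real_group_structure ?P" by (rule real_group_structure_pair[OF assms(2)])
  then interpret P: real_group_structure ?P .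
  have R: "universe R = UNIV" using assms(2) by (simp add: expands_real_group_def)
  have K: "universe ?K = UNIV" by (rule universe_real_completion[OF P H(1)])
  have "rel ?P None \<inter> tuples UNIV 1 = tuples H 1" by (auto simp: pair_def tuples_def length_Suc_conv)
  then have defH: "definable ?P 1 (tuples H 1)"
    using definable_rel[of ?P 1 None] P.univ by simp
  have "definable R n X" if X: "definable ?K n X" for n X
  proof (rule definable_transfer[OF _ _ _ _ X])
    show "definable R 1 (tuples (universe ?K) 1)" using definable_universe[of R 1] R K by simp
    fix r m
    show "definable R m (rel ?K r \<inter> tuples (universe ?K) m)"
      using rel_real_completion[OF P H(1), of r]
    proof (elim disjE exE conjE)
      assume "rel ?K r = {}"
      then show ?thesis using R by (simp add: definable_empty)
    next
      fix k Y assume Y: "definable (induced H ?P) k Y" "rel ?K r = real_closure k Y"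
      have "definable ?P k (real_closure k Y)"
        using definable_of_induced[OF H(2) defH Y(1)] by (rule P.definable_real_closure)
      then have "definable R k (real_closure k Y)"
        by (rule closed_definable_pair[OF assms(2,4) _ real_closure_idem])
      moreover have "rel ?K r \<inter> tuples UNIV m = (if m = k then real_closure k Y else {})"
        unfolding Y(2) by (auto simp: real_closure_def tuples_def)
      ultimately show ?thesis using R K by (simp add: definable_empty)
    qed
  qed (simp_all add: R K)
  moreover have "definable ?K n X" if X: "definable R n X" for n X
  proof (rule definable_from_closed[OF assms(2,4) K _ X])
    fix m Z assume Z: "definable ?P m Z" "real_closure m Z = Z"
    have "definable (induced H ?P) (Suc m) (tuples H (Suc m) \<inter> nbhd_graph m Z)"
      by (rule definable_induced_trace[OF H(2) P.definable_nbhd_graph[OF Z(1)]])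
    then have "definable ?K (Suc m) (real_closure (Suc m) (tuples H (Suc m) \<inter> nbhd_graph m Z))"
      by (rule definable_completion_real_closure[OF P H(1)])
    from definable_all_last[OF _ this] show "definable ?K m Z"
      using closed_from_trace_of_nbhd_graph[OF H(1) Z(2)] K by simp
  qed
  ultimately show ?thesis using R K by (auto simp: interdefinable_def)
qed

end
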